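(* Let $a<b$ be real numbers, let $k\ge 0$ be an integer, and let $f:[a,b]\to\mathbb{R}$ be such that $f, f',\ldots,f^{(k-1)}$ are absolutely continuous on $[a,b]$ (no condition of this kind if $k=0$). Put $$V_k:=\|f^{(k)}\|_T=\int_0^\pi \left|f^{(k+1)}(\mathsf{G}(\cos\theta))\right|\,d\theta ,$$ where $f^{(k+1)}$ is the distributional derivative of $f^{(k)}$, and suppose that $V_k<\infty$. Let $c_j$ denote the Chebyshev coefficients of $f$ on $[a,b]$. Then for every integer $j\ge k+1$, $$|c_j|\le \left(\frac{b-a}{2}\right)^{2s+1}\frac{2V_k}{\pi\prod_{i=-s}^{s}(j+2i)}\quad\text{if } k=2s \text{ with } s\ge 0 \text{ an integer},$$ and $$|c_j|\le \left(\frac{b-a}{2}\right)^{2s+2}\frac{2V_k}{\pi\prod_{i=-s}^{s+1}(j+2i-1)}\quad\text{if } k=2s+1 \text{ with } s\ge 0 \text{ an integer}.$$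
   Context: The map $\mathsf{G}:[-1,1]\to[a,b]$ is the bijection $\mathsf{G}(t)=a+\frac{b-a}{2}(t+1)$. The Chebyshev coefficients of $f:[a,b]\to\mathbb{R}$ are $$c_j=\frac{2}{\pi}\int_{-1}^{1}\frac{f(\mathsf{G}(t))T_j(t)}{\sqrt{1-t^2}}\,dt=\frac{2}{\pi}\int_0^\pi f(\mathsf{G}(\cos\theta))\cos(j\theta)\,d\theta,\qquad j=0,1,2,\ldots,$$ where $T_j(t)=\cos(j\cos^{-1}t)$ is the Chebyshev polynomial of the first kind of degree $j$. For a function $h$ on $[a,b]$, $\|h\|_T:=\int_0^\pi|h'(\mathsf{G}(\cos\theta))|\,d\theta$, where $h'$ is the weak (distributional) derivative. If $h$ is absolutely continuous, this is an ordinary Lebesgue integral. If the distributional derivative of $h$ on $(a,b)$ is only a signed Radon measure $Dh$ (for example, if $h$ has jumps), then, by the change of variables $x=\mathsf{G}(\cos\theta)$, the integral is understood as $\|h\|_T=\int_{(a,b)}\frac{d|Dh|(x)}{\sqrt{(x-a)(b-x)}}$, where $|Dh|$ is the total variation measure. The condition $\|h\|_T<\infty$ includes the requirement that the distributional derivative of $h$ is such a measure. *)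

theory Defs
  imports "HOL-Analysis.Analysis"
begin

definition G_map :: "real \<Rightarrow> real \<Rightarrow> real \<Rightarrow> real" where
  "G_map a b t = a + (b - a) / 2 * (t + 1)"

definition cheb_T :: "nat \<Rightarrow> real \<Rightarrow> real" where
  "cheb_T j t = cos (real j * arccos t)"

definition cheb_coeff :: "real \<Rightarrow> real \<Rightarrow> (real \<Rightarrow> real) \<Rightarrow> nat \<Rightarrow> real" where
  "cheb_coeff a b f j =
     2 / pi * (LINT t:{-1..1}|lebesgue. f (G_map a b t) * cheb_T j t / sqrt (1 - t\<^sup>2))"

definition abs_cont_on :: "real \<Rightarrow> real \<Rightarrow> (real \<Rightarrow> real) \<Rightarrow> bool" where
  "abs_cont_on a b h \<longleftrightarrow>
     (\<forall>\<epsilon>>0. \<exists>\<delta>>0. \<forall>P :: (real \<times> real) set.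
        finite P \<longrightarrow> (\<forall>(c, d)\<in>P. a \<le> c \<and> c < d \<and> d \<le> b) \<longrightarrow>
        disjoint_family_on (\<lambda>(c, d). {c<..<d}) P \<longrightarrow>
        (\<Sum>(c, d)\<in>P. d - c) < \<delta> \<longrightarrow> (\<Sum>(c, d)\<in>P. \<bar>h d - h c\<bar>) < \<epsilon>)"

definition test_fun :: "real \<Rightarrow> real \<Rightarrow> (real \<Rightarrow> real) \<Rightarrow> bool" where
  "test_fun a b \<phi> \<longleftrightarrow>
     (\<forall>n. (deriv ^^ n) \<phi> differentiable_on UNIV) \<and>
     compact (closure {x. \<phi> x \<noteq> 0}) \<and> closure {x. \<phi> x \<noteq> 0} \<subseteq> {a<..<b}"

definition loc_integrable :: "real \<Rightarrow> real \<Rightarrow> (real \<Rightarrow> real) \<Rightarrow> bool" where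
  "loc_integrable a b h \<longleftrightarrow>
     (\<forall>c d. a < c \<and> c \<le> d \<and> d < b \<longrightarrow> h absolutely_integrable_on {c..d})"

text \<open>The distributional derivative of \<open>h\<close> on \<open>(a,b)\<close> is the locally integrable function \<open>g\<close>
  (which is thereby determined up to a null set).\<close>

definition weak_deriv :: "real \<Rightarrow> real \<Rightarrow> (real \<Rightarrow> real) \<Rightarrow> (real \<Rightarrow> real) \<Rightarrow> bool" where
  "weak_deriv a b h g \<longleftrightarrow>
     loc_integrable a b h \<and> loc_integrable a b g \<and>
     (\<forall>\<phi>. test_fun a b \<phi> \<longrightarrow>
        (LINT x:{a<..<b}|lebesgue. h x * deriv \<phi> x) = - (LINT x:{a<..<b}|lebesgue. g x * \<phi> x))"

text \<open>Signed Radon measures on \<open>(a,b)\<close> are represented by their Jordan decomposition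
  \<open>M - N\<close>: two mutually singular positive Borel measures, finite on compact subsets of \<open>(a,b)\<close>.
  The pair is determined by the signed measure, whose total variation is \<open>M + N\<close>.\<close>

definition jordan_pair :: "real \<Rightarrow> real \<Rightarrow> real measure \<Rightarrow> real measure \<Rightarrow> bool" where
  "jordan_pair a b M N \<longleftrightarrow>
     sets M = sets (restrict_space borel {a<..<b}) \<and>
     sets N = sets (restrict_space borel {a<..<b}) \<and>
     (\<forall>c d. a < c \<and> c \<le> d \<and> d < b \<longrightarrow> emeasure M {c..d} < \<infinity> \<and> emeasure N {c..d} < \<infinity>) \<and>
     (\<exists>P\<in>sets M. emeasure M ({a<..<b} - P) = 0 \<and> emeasure N P = 0)"

definition weak_deriv_measure ::
  "real \<Rightarrow> real \<Rightarrow> (real \<Rightarrow> real) \<Rightarrow> real measure \<Rightarrow> real measure \<Rightarrow> bool" where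
  "weak_deriv_measure a b h M N \<longleftrightarrow>
     loc_integrable a b h \<and> jordan_pair a b M N \<and>
     (\<forall>\<phi>. test_fun a b \<phi> \<longrightarrow>
        (LINT x:{a<..<b}|lebesgue. h x * deriv \<phi> x) = - ((LINT x|M. \<phi> x) - (LINT x|N. \<phi> x)))"

text \<open>The value is infinite if the distributional derivative of \<open>h\<close> is not a signed Radon measure.
  The choices do not matter: a weak derivative is unique up to a null set, and the Jordan pair of
  the distributional derivative is unique.\<close>

definition T_norm :: "real \<Rightarrow> real \<Rightarrow> (real \<Rightarrow> real) \<Rightarrow> ennreal" where
  "T_norm a b h =
     (if \<exists>g. weak_deriv a b h g then
        (let g = (SOME g. weak_deriv a b h g)
         in \<integral>\<^sup>+\<theta>\<in>{0..pi}. ennreal \<bar>g (G_map a b (cos \<theta>))\<bar> \<partial>lebesgue)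
      else if \<exists>M N. weak_deriv_measure a b h M N then
        (let (M, N) = (SOME (M, N). weak_deriv_measure a b h M N);
             w = (\<lambda>x. ennreal (1 / sqrt ((x - a) * (b - x))))
         in (\<integral>\<^sup>+x. w x \<partial>M) + (\<integral>\<^sup>+x. w x \<partial>N))
      else \<infinity>)"

text \<open>\<open>D i\<close> plays the role of the \<open>i\<close>-th derivative of \<open>f\<close> for \<open>i \<le> k\<close>, where
  \<open>f, \<dots>, f\<^sup>(\<^sup>k\<^sup>-\<^sup>1\<^sup>)\<close> are absolutely continuous on \<open>[a,b]\<close>. The almost everywhere derivative of an
  absolutely continuous function is its weak derivative; for \<open>0 < i < k\<close> the continuous
  representative \<open>D i\<close> is the ordinary derivative, and \<open>D k\<close> is determined almost everywhere
  (for \<open>k = 0\<close> it is \<open>f\<close>).\<close>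

definition abs_cont_derivs ::
  "real \<Rightarrow> real \<Rightarrow> nat \<Rightarrow> (real \<Rightarrow> real) \<Rightarrow> (nat \<Rightarrow> real \<Rightarrow> real) \<Rightarrow> bool" where
  "abs_cont_derivs a b k f D \<longleftrightarrow>
     (\<forall>x\<in>{a..b}. D 0 x = f x) \<and>
     (\<forall>i<k. abs_cont_on a b (D i) \<and> weak_deriv a b (D i) (D (Suc i)))"

lemma cheb_coeff_cos:
  "cheb_coeff a b f j =
     2 / pi * (LINT \<theta>:{0..pi}|lebesgue. f (G_map a b (cos \<theta>)) * cos (real j * \<theta>))"
proof -
  let ?F = "\<lambda>t. f (G_map a b t) * cheb_T j t / sqrt (1 - t\<^sup>2)"
  let ?H = "\<lambda>\<theta>. f (G_map a b (cos \<theta>)) * cos (real j * \<theta>)"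
  have spike: "(LINT x:S|lebesgue. h x) = (LINT x:T|lebesgue. h x)"
    if "negligible ((S - T) \<union> (T - S))" for S T :: "real set" and h :: "real \<Rightarrow> real"
  proof -
    have n: "negligible {x \<in> S - T. h x \<noteq> 0}" "negligible {x \<in> T - S. h x \<noteq> 0}"
      by (auto intro: negligible_subset[OF that])
    have ai: "h absolutely_integrable_on S \<longleftrightarrow> h absolutely_integrable_on T"
      by (rule absolutely_integrable_spike_set_eq) (use n in auto)
    show ?thesis
    proof (cases "h absolutely_integrable_on S")
      case True
      then show ?thesis
        using ai integral_spike_set[OF n] by (simp add: set_lebesgue_integral_eq_integral(2))
    next
      case False
      then show ?thesis
        using ai
        by (simp add: set_lebesgue_integral_def set_integrable_def not_integrable_integral_eq)
    qed
  qed
  have inj: "inj_on cos {0<..<pi}"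
    by (auto intro!: inj_onI cos_inj_pi)
  have im: "cos ` {0<..<pi} = {-1<..<1}"
  proof (intro equalityI subsetI)
    fix t :: real assume "t \<in> cos ` {0<..<pi}"
    then obtain x where "0 < x" "x < pi" "t = cos x" by auto
    then show "t \<in> {-1<..<1}"
      using cos_monotone_0_pi[of 0 x] cos_monotone_0_pi[of x pi] by auto
  next
    fix t :: real assume "t \<in> {-1<..<1}"
    then show "t \<in> cos ` {0<..<pi}"
      by (intro image_eqI[of _ _ "arccos t"]) (auto simp: arccos_lt_bounded)
  qed
  have der: "(cos has_field_derivative - sin x) (at x within {0<..<pi})" for x :: real
    by (auto intro!: derivative_eq_intros)
  have eq: "\<bar>- sin x\<bar> *\<^sub>R ?F (cos x) = ?H x" if "x \<in> {0<..<pi}" for x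
  proof -
    have "0 < sin x" using that by (auto intro: sin_gt_zero)
    moreover have "sqrt (1 - (cos x)\<^sup>2) = sin x"
      using \<open>0 < sin x\<close> by (simp add: sin_squared_eq[symmetric])
    ultimately show ?thesis
      using that by (simp add: cheb_T_def arccos_cos)
  qed
  have ai: "?F absolutely_integrable_on {-1<..<1} \<longleftrightarrow> ?H absolutely_integrable_on {0<..<pi}"
  proof -
    have "?F absolutely_integrable_on {-1<..<1} \<longleftrightarrow>
        (\<lambda>x. \<bar>- sin x\<bar> *\<^sub>R ?F (cos x)) absolutely_integrable_on {0<..<pi}"
      unfolding im[symmetric]
      by (rule absolutely_integrable_change_of_variables_real) (use der inj in auto)
    also have "\<dots> \<longleftrightarrow> ?H absolutely_integrable_on {0<..<pi}"
      by (rule set_integrable_cong) (use eq in auto)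
    finally show ?thesis .
  qed
  have "(LINT t:{-1<..<1}|lebesgue. ?F t) = (LINT \<theta>:{0<..<pi}|lebesgue. ?H \<theta>)"
  proof (cases "?F absolutely_integrable_on {-1<..<1}")
    case True
    have "(\<lambda>x. \<bar>- sin x\<bar> * ?F (cos x)) absolutely_integrable_on {0<..<pi} \<and>
        integral {0<..<pi} (\<lambda>x. \<bar>- sin x\<bar> * ?F (cos x)) = integral {-1<..<1} ?F"
      using has_absolute_integral_change_of_variables_1'[OF _ der inj,
          of ?F "integral {-1<..<1} ?F"] True im by auto
    moreover have "integral {0<..<pi} (\<lambda>x. \<bar>- sin x\<bar> * ?F (cos x)) = integral {0<..<pi} ?H"
      by (rule integral_cong) (use eq in auto)
    ultimately show ?thesis
      using True ai by (simp add: set_lebesgue_integral_eq_integral(2))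
  next
    case False
    then show ?thesis
      using ai by (simp add: set_lebesgue_integral_def set_integrable_def not_integrable_integral_eq)
  qed
  moreover have "(LINT t:{-1..1}|lebesgue. ?F t) = (LINT t:{-1<..<1}|lebesgue. ?F t)"
    by (rule spike) (auto intro: negligible_subset[of "{-1, 1}"])
  moreover have "(LINT \<theta>:{0..pi}|lebesgue. ?H \<theta>) = (LINT \<theta>:{0<..<pi}|lebesgue. ?H \<theta>)"
    by (rule spike) (auto intro: negligible_subset[of "{0, pi}"])
  ultimately show ?thesis unfolding cheb_coeff_def by simp
qed

end

theory Submission
  imports Defs
begin

text \<open>By the du Bois-Reymond lemma, a function whose distributional derivative is a finite signed
  measure \<open>\<mu>\<close> on \<open>(a,b)\<close> agrees almost everywhere with \<open>C + \<mu>((a,x])\<close>. Fubini's theorem then plays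
  the part of integration by parts and turns the \<open>j\<close>-th Chebyshev coefficient into
  \<open>2/(\<pi>j)\<close> times the \<open>\<mu>\<close>-integral of \<open>sin(j\<theta>)\<close> with \<open>x = G(cos \<theta>)\<close>. This is at most
  \<open>2|\<mu>|/(\<pi>j)\<close>, and the weight in \<open>V\<close> is at least \<open>2/(b-a)\<close>, which settles \<open>k = 0\<close>. If \<open>\<mu>\<close> has
  a bounded density \<open>f'\<close>, the product formula for \<open>sin(j\<theta>) sin \<theta>\<close> yields
  \<open>c_j(f) = (b-a)/2 * (c_{j-1}(f') - c_{j+1}(f'))/(2j)\<close>, and the bound follows by induction on \<open>k\<close>.
  Going down the chain of weak derivatives, each one is almost everywhere bounded because its own
  derivative is a finite measure.\<close>

section \<open>Smooth bump functions and the du Bois-Reymond lemma\<close>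

text \<open>Both products in the statement are the product of the k + 1 numbers j - k, j - k + 2,
  ..., j + k, positive because j \<ge> k + 1. The recurrence leads from (k, j) to (k - 1, j - 1) and
  (k - 1, j + 1), whose progressions are this one without its last and without its first term; this
  is why the estimate reproduces itself exactly in the induction. The two branches of
  \<open>T_norm\<close> call for a common form: a density and a Radon measure are both written as a
  difference of two finite measures, and only their masses and their action on functions enter. The
  factor (b - a)/2 appears in each branch for the same reason, sin \<theta> \<le> 1, which for x =
  G(cos \<theta>) is the inequality between the geometric and the arithmetic mean of x - a and b -
  x. The obstacles are that weak derivatives are fixed only up to null sets and that integrals of
  non-integrable functions default to 0. Hence the passage to Borel representatives, the transport
  of null sets through x = G(cos \<theta>), and the need to bound the intermediate derivatives
  before the integral in the recurrence may be split.\<close>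

primrec n_diff :: "nat \<Rightarrow> (real \<Rightarrow> real) \<Rightarrow> bool" where
  "n_diff 0 f \<longleftrightarrow> f differentiable_on UNIV"
| "n_diff (Suc n) f \<longleftrightarrow> f differentiable_on UNIV \<and> n_diff n (deriv f)"

lemma n_diff_has_deriv:
  assumes "n_diff n f"
  shows "(f has_real_derivative deriv f x) (at x)"
proof -
  have "f differentiable_on UNIV" using assms by (cases n) auto
  then show ?thesis
    by (metis DERIV_deriv_iff_real_differentiable UNIV_I differentiable_on_def)
qed

text \<open>Link to \<open>test_fun\<close>, which speaks of iterates of \<open>deriv\<close>. The
  recursion in \<open>n_diff\<close> takes off the first derivative instead, which is the form in
  which the sum, product and chain rules go through by induction.\<close>

lemma n_diff_iterate_deriv: "n_diff n f \<Longrightarrow> (deriv ^^ n) f differentiable_on UNIV"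
  by (induction n arbitrary: f) (auto simp: funpow_swap1)

lemma has_deriv_imp_n_diff:
  assumes "\<And>x. (f has_real_derivative f' x) (at x)" and "n_diff n f'"
  shows "n_diff (Suc n) f"
proof -
  have "deriv f = f'"
    using assms(1) by (auto intro: DERIV_imp_deriv)
  moreover have "f differentiable_on UNIV"
    using assms(1) by (meson differentiable_at_imp_differentiable_on real_differentiable_def)
  ultimately show ?thesis using assms(2) by simp
qed

text \<open>For the product rule, where each summand keeps one factor undifferentiated.\<close>

lemma n_diff_Suc_imp: "n_diff (Suc n) f \<Longrightarrow> n_diff n f"
  by (induction n arbitrary: f) auto

lemma n_diff_add: "n_diff n f \<Longrightarrow> n_diff n g \<Longrightarrow> n_diff n (\<lambda>x. f x + g x)"
proof (induction n arbitrary: f g)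
  case (Suc n)
  have "((\<lambda>x. f x + g x) has_real_derivative deriv f x + deriv g x) (at x)" for x
    using n_diff_has_deriv[OF Suc.prems(1)] n_diff_has_deriv[OF Suc.prems(2)]
    by (auto intro: derivative_eq_intros)
  then show ?case
    by (rule has_deriv_imp_n_diff) (use Suc in auto)
qed auto

lemma n_diff_mult: "n_diff n f \<Longrightarrow> n_diff n g \<Longrightarrow> n_diff n (\<lambda>x. f x * g x)"
proof (induction n arbitrary: f g)
  case (Suc n)
  have "((\<lambda>x. f x * g x) has_real_derivative deriv f x * g x + f x * deriv g x) (at x)" for x
    using n_diff_has_deriv[OF Suc.prems(1)] n_diff_has_deriv[OF Suc.prems(2)]
    by (auto intro!: derivative_eq_intros)
  then show ?case
    by (rule has_deriv_imp_n_diff)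
      (use Suc n_diff_Suc_imp in \<open>auto intro!: n_diff_add\<close>)
qed auto

lemma n_diff_const: "n_diff n (\<lambda>x. c)"
  by (induction n arbitrary: c) auto

lemma n_diff_affine: "n_diff n f \<Longrightarrow> n_diff n (\<lambda>x. f (\<alpha> * x + \<beta>))"
proof (induction n arbitrary: f)
  case 0
  have "((\<lambda>x. f (\<alpha> * x + \<beta>)) has_real_derivative deriv f (\<alpha> * x + \<beta>) * \<alpha>) (at x)" for x
    by (rule DERIV_chain2[OF n_diff_has_deriv[OF 0]]) (auto intro!: derivative_eq_intros)
  then show ?case
    by (metis n_diff.simps(1) differentiable_at_imp_differentiable_on real_differentiable_def)
next
  case (Suc n)
  have "((\<lambda>x. f (\<alpha> * x + \<beta>)) has_real_derivative \<alpha> * deriv f (\<alpha> * x + \<beta>)) (at x)" for x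
    by (subst mult.commute, rule DERIV_chain2[OF n_diff_has_deriv[OF Suc.prems]])
      (auto intro!: derivative_eq_intros)
  then show ?case
    by (rule has_deriv_imp_n_diff) (use Suc in \<open>auto intro!: n_diff_mult n_diff_const\<close>)
qed

text \<open>The family \<open>P(1/x) exp(-1/x)\<close> for polynomials \<open>P\<close> is closed under differentiation.\<close>

definition flat :: "real poly \<Rightarrow> real \<Rightarrow> real" where
  "flat p x = (if x > 0 then poly p (1 / x) * exp (- (1 / x)) else 0)"

lemma tendsto_poly_exp_neg: "((\<lambda>y::real. poly p y * exp (- y)) \<longlongrightarrow> 0) at_top"
proof -
  have "((\<lambda>y::real. \<Sum>i\<le>degree p. coeff p i * (y ^ i / exp y)) \<longlongrightarrow> (\<Sum>i\<le>degree p. coeff p i * 0)) at_top"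
    by (intro tendsto_intros tendsto_power_div_exp_0)
  then show ?thesis
    by (simp add: poly_altdef exp_minus sum_distrib_right divide_inverse mult.assoc)
qed

lemma tendsto_flat_at_0: "(flat p \<longlongrightarrow> 0) (at_right 0)"
proof -
  have "((\<lambda>x::real. poly p (inverse x) * exp (- inverse x)) \<longlongrightarrow> 0) (at_right 0)"
    by (rule filterlim_compose[OF tendsto_poly_exp_neg filterlim_inverse_at_top_right])
  then show ?thesis
    by (rule Lim_transform_eventually)
      (auto simp: flat_def inverse_eq_divide eventually_at_filter)
qed

text \<open>With y = 1/x the derivative of p(y) exp(-y) in x is y^2 (p(y) - p'(y)) exp(-y), and
  \<open>[:0, 0, 1:]\<close> is the polynomial y^2. Only the origin needs an argument of its
  own.\<close>

lemma flat_has_deriv: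
  "(flat p has_real_derivative flat ([:0, 0, 1:] * (p - pderiv p)) x) (at x)"
proof -
  consider "x > 0" | "x < 0" | "x = 0" by linarith
  then show ?thesis
  proof cases
    case 1
    have "((\<lambda>x. poly p (1 / x) * exp (- (1 / x))) has_real_derivative
        flat ([:0, 0, 1:] * (p - pderiv p)) x) (at x)"
      using 1
      by (auto intro!: derivative_eq_intros DERIV_chain2[OF poly_DERIV]
          simp: flat_def field_simps power2_eq_square)
    then show ?thesis
      by (rule has_field_derivative_transform_within_open[of _ _ _ "{0<..}"])
        (use 1 in \<open>auto simp: flat_def\<close>)
  next
    case 2
    have "((\<lambda>x::real. 0) has_real_derivative flat ([:0, 0, 1:] * (p - pderiv p)) x) (at x)"
      using 2 by (auto simp: flat_def)
    then show ?thesis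
      by (rule has_field_derivative_transform_within_open[of _ _ _ "{..<0}"])
        (use 2 in \<open>auto simp: flat_def\<close>)
  next
    case 3
    \<comment> \<open>Dividing by the argument multiplies the polynomial in its reciprocal by the
      variable, so the difference quotient belongs to the family again and tends to 0.\<close>
    have "((\<lambda>y. (flat p y - flat p 0) / (y - 0)) \<longlongrightarrow> 0) (at_right 0)"
      by (rule Lim_transform_eventually[OF tendsto_flat_at_0[of "[:0, 1:] * p"]])
        (auto simp: flat_def eventually_at_filter)
    moreover have "((\<lambda>y. (flat p y - flat p 0) / (y - 0)) \<longlongrightarrow> 0) (at_left 0)"
      by (rule Lim_transform_eventually[OF tendsto_const])
        (auto simp: flat_def eventually_at_filter)
    ultimately show ?thesis
      using 3 by (simp add: has_field_derivative_iff filterlim_split_at flat_def)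
  qed
qed

lemma n_diff_flat: "n_diff n (flat p)"
proof (induction n arbitrary: p)
  case 0
  show ?case
    using flat_has_deriv
    by (metis n_diff.simps(1) differentiable_at_imp_differentiable_on real_differentiable_def)
next
  case (Suc n)
  show ?case by (rule has_deriv_imp_n_diff[OF flat_has_deriv Suc])
qed

text \<open>\<open>flat 1 (n x) = exp(-1/(n x))\<close> tends to \<open>1\<close> for \<open>x > 0\<close>, so these test functions converge
  boundedly to the indicator of \<open>(c,d)\<close>.\<close>

definition bump :: "real \<Rightarrow> real \<Rightarrow> nat \<Rightarrow> real \<Rightarrow> real" where
  "bump c d n x = flat 1 (real n * (x - c)) * flat 1 (real n * (d - x))"

lemma n_diff_bump: "n_diff m (bump c d n)"
proof -
  have "bump c d n = (\<lambda>x. flat 1 (real n * x + - (real n * c)) * flat 1 (- real n * x + real n * d))"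
    by (auto simp: bump_def algebra_simps)
  then show ?thesis
    by (simp only:) (intro n_diff_mult n_diff_affine n_diff_flat)
qed

lemma flat_1_bounds: "0 \<le> flat 1 x" "flat 1 x \<le> 1"
  by (auto simp: flat_def)

lemma bump_nonneg: "0 \<le> bump c d n x" and bump_le_1: "bump c d n x \<le> 1"
  using flat_1_bounds mult_mono[of "flat 1 (real n * (x - c))" 1 "flat 1 (real n * (d - x))" 1]
  by (auto simp: bump_def)

lemma bump_eq_0: "x \<notin> {c<..<d} \<Longrightarrow> bump c d n x = 0"
  by (auto simp: bump_def flat_def not_less zero_less_mult_iff)

lemma tendsto_flat_1: "(\<lambda>n. flat 1 (real n * x)) \<longlonglongrightarrow> indicator {0<..} x"
proof (cases "x > 0")
  case True
  have "(\<lambda>n. exp (- (1 / x * (1 / real n)))) \<longlonglongrightarrow> exp (- (1 / x * 0))"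
    by (intro tendsto_intros lim_const_over_n)
  moreover have "\<forall>\<^sub>F n in sequentially. exp (- (1 / x * (1 / real n))) = flat 1 (real n * x)"
    using eventually_gt_at_top[of 0] by eventually_elim (use True in \<open>auto simp: flat_def mult_ac\<close>)
  ultimately show ?thesis
    using True by (auto intro: Lim_transform_eventually)
next
  case False
  then have "flat 1 (real n * x) = 0" for n
    by (auto simp: flat_def zero_less_mult_iff)
  then show ?thesis using False by simp
qed

lemma tendsto_bump: "(\<lambda>n. bump c d n x) \<longlonglongrightarrow> indicator {c<..<d} x"
proof -
  have "(\<lambda>n. bump c d n x) \<longlonglongrightarrow> indicator {0<..} (x - c) * indicator {0<..} (d - x)"
    unfolding bump_def by (intro tendsto_intros tendsto_flat_1)
  moreover have "indicator {0<..} (x - c) * indicator {0<..} (d - x) = (indicator {c<..<d} x :: real)"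
    by (simp add: indicator_def)
  ultimately show ?thesis by simp
qed

lemma continuous_bump: "continuous_on A (bump c d n)"
  by (meson DERIV_isCont continuous_at_imp_continuous_on n_diff_has_deriv n_diff_bump)

text \<open>Mean zero is what makes the antiderivative that vanishes at c vanish again to the right
  of d, so that it has compact support. This supplies the test functions for the du Bois-Reymond
  argument.\<close>

lemma test_fun_antideriv:
  assumes "a < c" "c \<le> d" "d < b" and \<psi>: "\<And>n. n_diff n \<psi>"
    and supp: "\<And>x. x \<notin> {c..d} \<Longrightarrow> \<psi> x = 0" and mean: "(LBINT x. \<psi> x) = 0"
  obtains \<phi> where "test_fun a b \<phi>" "deriv \<phi> = \<psi>"
proof -
  have cont: "isCont \<psi> x" for x
    using n_diff_has_deriv[OF \<psi>] DERIV_isCont by blast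
  obtain F where F: "\<And>x. (F has_vector_derivative \<psi> x) (at x)"
    using einterval_antiderivative[of "-\<infinity>" \<infinity> \<psi>] cont by auto
  define \<phi> where "\<phi> x = F x - F c" for x
  have der: "(\<phi> has_real_derivative \<psi> x) (at x)" for x
    unfolding \<phi>_def has_real_derivative_iff_has_vector_derivative
    by (auto intro!: derivative_eq_intros F)
  have FTC: "(LBINT x:{p..q}. \<psi> x) = \<phi> q - \<phi> p" if "p \<le> q" for p q
    unfolding set_lebesgue_integral_def
    by (rule integral_FTC_atLeastAtMost[OF that])
      (use der cont in \<open>auto simp: has_real_derivative_iff_has_vector_derivative
        intro: has_vector_derivative_at_within continuous_at_imp_continuous_on\<close>)
  have zero: "\<phi> x = 0" if x: "x \<notin> {c..d}" for x
  proof -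
    consider "x < c" | "x > d" using x by fastforce
    then show ?thesis
    proof cases
      case 1
      have "(LBINT y:{x..c}. \<psi> y) = (LBINT y:{x..c}. 0)"
      proof (rule set_lebesgue_integral_cong_AE)
        show "AE y\<in>{x..c} in lborel. \<psi> y = 0"
          \<comment> \<open>\<open>supp\<close> says nothing at c itself, but one point is a null
            set.\<close>
          using AE_lborel_singleton[of c] by eventually_elim (use supp in force)
      qed (use cont in \<open>auto intro!: borel_measurable_continuous_onI continuous_at_imp_continuous_on\<close>)
      then show ?thesis using 1 FTC[of x c] by (simp add: \<phi>_def)
    next
      case 2
      have "(LBINT y:{c..x}. \<psi> y) = (LBINT y. \<psi> y)"
        unfolding set_lebesgue_integral_def
        by (rule Bochner_Integration.integral_cong) (use supp 2 in \<open>force simp: indicator_def\<close>)+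
      then show ?thesis using 2 assms(2) FTC[of c x] mean by (simp add: \<phi>_def)
    qed
  qed
  have sub: "closure {x. \<phi> x \<noteq> 0} \<subseteq> {c..d}"
    by (rule closure_minimal) (use zero in force)+
  have "(deriv ^^ n) \<phi> differentiable_on UNIV" for n
    using n_diff_iterate_deriv[OF has_deriv_imp_n_diff[OF der \<psi>], of n]
      n_diff_iterate_deriv[OF n_diff_Suc_imp[OF has_deriv_imp_n_diff[OF der \<psi>]], of n]
    by simp
  moreover have "compact (closure {x. \<phi> x \<noteq> 0})"
    using sub by (meson closed_closure compact_Icc compact_closure bounded_subset compact_eq_bounded_closed)
  ultimately have "test_fun a b \<phi>"
    using sub assms(1-3) unfolding test_fun_def by force
  moreover have "deriv \<phi> = \<psi>" using der by (auto intro: DERIV_imp_deriv)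
  ultimately show thesis by (rule that)
qed

section \<open>Interval averages and functions with vanishing weak derivative\<close>

lemma borel_measurable_bump [measurable]: "bump c d n \<in> borel_measurable borel"
  by (rule borel_measurable_continuous_onI[OF continuous_bump])

lemma bump_integral:
  assumes u [measurable]: "u \<in> borel_measurable borel"
    and int: "set_integrable lborel {c..d} u"
  shows integrable_bump: "integrable lborel (\<lambda>x. u x * bump c d n x)"
    and tendsto_integral_bump:
      "(\<lambda>n. LBINT x. u x * bump c d n x) \<longlonglongrightarrow> (LBINT x:{c<..<d}. u x)"
proof -
  have int': "integrable lborel (\<lambda>x. \<bar>indicator {c..d} x * u x\<bar>)"
    using int by (simp add: set_integrable_def)
  have bound: "\<bar>u x * bump c d n x\<bar> \<le> \<bar>indicator {c..d} x * u x\<bar>" for x n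
  proof (cases "x \<in> {c<..<d}")
    case True
    then show ?thesis
      using bump_nonneg[of c d n x] bump_le_1[of c d n x]
      by (auto simp: abs_mult intro: mult_left_le)
  qed (simp add: bump_eq_0)
  show "integrable lborel (\<lambda>x. u x * bump c d n x)"
    by (rule Bochner_Integration.integrable_bound[OF int']) (use bound in auto)
  show "(\<lambda>n. LBINT x. u x * bump c d n x) \<longlonglongrightarrow> (LBINT x:{c<..<d}. u x)"
    unfolding set_lebesgue_integral_def
  proof (rule integral_dominated_convergence[OF _ _ int'])
    show "AE x in lborel. (\<lambda>n. u x * bump c d n x) \<longlonglongrightarrow> indicator {c<..<d} x *\<^sub>R u x"
      using tendsto_mult[OF tendsto_const tendsto_bump] by (auto simp: mult.commute)
  qed (use bound in auto)
qed

text \<open>Since \<open>ennreal\<close> cuts off at 0, \<open>?p\<close> and \<open>?m\<close> are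
  the positive and the negative part of v. As densities they define measures that agree, with finite
  values, on all open upper half-lines; so the measures agree, hence the densities almost
  everywhere, and v must vanish there.\<close>

lemma AE_zero_if_interval_integrals_zero:
  fixes v :: "real \<Rightarrow> real"
  assumes v: "integrable lborel v" and 0: "\<And>x. (LBINT y:{x<..}. v y) = 0"
  shows "AE x in lborel. v x = 0"
proof -
  have [measurable]: "v \<in> borel_measurable borel" using v by auto
  let ?p = "\<lambda>x. ennreal (v x)" and ?m = "\<lambda>x. ennreal (- v x)"
  have *: "(\<integral>\<^sup>+x. ?p x * indicator {y<..} x \<partial>lborel) = (\<integral>\<^sup>+x. ?m x * indicator {y<..} x \<partial>lborel)
      \<and> (\<integral>\<^sup>+x. ?m x * indicator {y<..} x \<partial>lborel) < \<infinity>" for y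
  proof -
    let ?w = "\<lambda>x. indicator {y<..} x * v x"
    have w: "integrable lborel ?w"
      using integrable_mult_indicator[OF _ v, of "{y<..}"] by simp
    have e: "(\<integral>\<^sup>+x. ?p x * indicator {y<..} x \<partial>lborel) = (\<integral>\<^sup>+x. ennreal (?w x) \<partial>lborel)"
      "(\<integral>\<^sup>+x. ?m x * indicator {y<..} x \<partial>lborel) = (\<integral>\<^sup>+x. ennreal (- ?w x) \<partial>lborel)"
      by (auto intro!: nn_integral_cong simp: indicator_def)
    have fin: "(\<integral>\<^sup>+x. ennreal (?w x) \<partial>lborel) < \<infinity>" "(\<integral>\<^sup>+x. ennreal (- ?w x) \<partial>lborel) < \<infinity>"
      using w unfolding real_integrable_def by (auto simp: top.not_eq_extremum)
    have "enn2real (\<integral>\<^sup>+x. ennreal (?w x) \<partial>lborel) = enn2real (\<integral>\<^sup>+x. ennreal (- ?w x) \<partial>lborel)"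
      using real_lebesgue_integral_def[OF w] 0[of y] by (simp add: set_lebesgue_integral_def)
    then have "(\<integral>\<^sup>+x. ennreal (?w x) \<partial>lborel) = (\<integral>\<^sup>+x. ennreal (- ?w x) \<partial>lborel)"
      using fin by (metis ennreal_enn2real infinity_ennreal_def)
    then show ?thesis using e fin by simp
  qed
  have "density lborel ?p = density lborel ?m"
    by (rule measure_eqI_lessThan) (use * in \<open>simp_all add: emeasure_density\<close>)
  then have "AE x in lborel. ?p x = ?m x"
    by (intro sigma_finite_measure.density_unique[OF sigma_finite_lborel]) auto
  then show ?thesis
  proof eventually_elim
    case (elim x)
    then show ?case
      by (cases "v x \<ge> 0") (auto simp: ennreal_neg ennreal_eq_0_iff)
  qed
qed

text \<open>Two bumps, each multiplied by the integral of the other, have a difference of mean zero,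
  which is the derivative of a test function and so annihilated by u. In the limit the averages of u
  over any two compact subintervals coincide.\<close>

lemma du_bois_reymond:
  assumes "a < b" and u [measurable]: "u \<in> borel_measurable borel"
    and int: "\<And>c d. a < c \<Longrightarrow> d < b \<Longrightarrow> set_integrable lborel {c..d} u"
    and 0: "\<And>\<phi>. test_fun a b \<phi> \<Longrightarrow> (LBINT x:{a<..<b}. u x * deriv \<phi> x) = 0"
  obtains C where "AE x in lborel. x \<in> {a<..<b} \<longrightarrow> u x = C"
proof -
  have one: "set_integrable lborel {c..d} (\<lambda>x. 1::real)" for c d :: real
    by (rule borel_integrable_atLeastAtMost') auto
  have ratio: "(d' - c') * (LBINT x:{c<..<d}. u x) = (d - c) * (LBINT x:{c'<..<d'}. u x)"
    if cd: "a < c" "c \<le> d" "d < b" "a < c'" "c' \<le> d'" "d' < b" for c d c' d'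
  proof -
    define I where "I n = (LBINT x. 1 * bump c d n x)" for n
    define J where "J n = (LBINT x. 1 * bump c' d' n x)" for n
    have int1: "integrable lborel (\<lambda>x. bump e f n x)" for e f n
      using integrable_bump[OF _ one, of e f n] by simp
    have eq: "J n * (LBINT x. u x * bump c d n x) = I n * (LBINT x. u x * bump c' d' n x)" for n
    proof -
      define \<psi> where "\<psi> x = J n * bump c d n x + (- I n) * bump c' d' n x" for x
      have mean: "(LBINT x. \<psi> x) = 0"
        unfolding \<psi>_def by (simp add: int1 I_def J_def)
      have diff: "n_diff m \<psi>" for m
        unfolding \<psi>_def by (intro n_diff_add n_diff_mult n_diff_const n_diff_bump)
      have supp: "\<psi> x = 0" if "x \<notin> {min c c'..max d d'}" for x
      proof -
        have "x \<notin> {c<..<d}" "x \<notin> {c'<..<d'}" using that by auto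
        then show ?thesis by (simp add: \<psi>_def bump_eq_0)
      qed
      obtain \<phi> where \<phi>: "test_fun a b \<phi>" "deriv \<phi> = \<psi>"
        by (rule test_fun_antideriv[OF _ _ _ diff supp mean, where a = a and b = b]) (use cd in auto)
      have "0 = (LBINT x:{a<..<b}. u x * \<psi> x)"
        using 0[OF \<phi>(1)] \<phi>(2) by simp
      also have "\<dots> = (LBINT x. J n * (u x * bump c d n x) - I n * (u x * bump c' d' n x))"
        unfolding set_lebesgue_integral_def \<psi>_def
      proof (rule Bochner_Integration.integral_cong[OF refl])
        fix x
        show "indicator {a<..<b} x *\<^sub>R (u x * (J n * bump c d n x + - I n * bump c' d' n x)) =
            J n * (u x * bump c d n x) - I n * (u x * bump c' d' n x)"
          by (cases "x \<in> {a<..<b}") (use cd in \<open>auto simp: bump_eq_0 algebra_simps\<close>)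
      qed
      also have "\<dots> = J n * (LBINT x. u x * bump c d n x) - I n * (LBINT x. u x * bump c' d' n x)"
        using cd by (simp add: integrable_bump int)
      finally show ?thesis by simp
    qed
    have I: "I \<longlonglongrightarrow> d - c" and J: "J \<longlonglongrightarrow> d' - c'"
      using tendsto_integral_bump[OF _ one, of c d] tendsto_integral_bump[OF _ one, of c' d'] cd
      unfolding I_def J_def by (simp_all add: set_lebesgue_integral_def)
    have "(\<lambda>n. J n * (LBINT x. u x * bump c d n x)) \<longlonglongrightarrow> (d' - c') * (LBINT x:{c<..<d}. u x)"
      using cd by (intro tendsto_mult J tendsto_integral_bump u int) auto
    moreover have "(\<lambda>n. I n * (LBINT x. u x * bump c' d' n x)) \<longlonglongrightarrow> (d - c) * (LBINT x:{c'<..<d'}. u x)"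
      using cd by (intro tendsto_mult I tendsto_integral_bump u int) auto
    ultimately show ?thesis
      unfolding eq by (rule LIMSEQ_unique)
  qed
  \<comment> \<open>The average of u over the middle third, as reference interval of length (b -
    a)/3.\<close>
  define C where "C = (LBINT x:{a + (b-a)/3<..<b - (b-a)/3}. u x) / ((b - a) / 3)"
  have C: "(LBINT x:{c<..<d}. u x) = C * (d - c)" if "a < c" "c \<le> d" "d < b" for c d
    using ratio[OF that, of "a + (b-a)/3" "b - (b-a)/3"] \<open>a < b\<close>
    by (simp add: C_def field_simps)
  have AE: "AE x in lborel. x \<in> {c<..<d} \<longrightarrow> u x = C" if cd: "a < c" "d < b" for c d
  proof -
    let ?v = "\<lambda>x. indicator {c<..<d} x * (u x - C)"
    have i: "set_integrable lborel {p<..<q} u" if "c \<le> p" "q \<le> d" for p q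
      by (rule set_integrable_subset[OF int[of p q]]) (use cd that in auto)
    have const: "set_integrable lborel {p<..<q} (\<lambda>x. C)" for p q :: real
      by (rule set_integrable_subset[OF borel_integrable_atLeastAtMost'[of p q]]) auto
    have "AE x in lborel. ?v x = 0"
    proof (rule AE_zero_if_interval_integrals_zero)
      show "integrable lborel ?v"
        using Bochner_Integration.integrable_diff[OF i[of c d, unfolded set_integrable_def]
            const[of c d, unfolded set_integrable_def]]
        by (simp add: right_diff_distrib)
      fix x
      \<comment> \<open>A half-line meets (c,d) in an interval or not at all, so the formula for C
        covers every half-line integral.\<close>
      have "(LBINT y:{x<..}. ?v y) = (LBINT y:{max c x<..<d}. u y - C)"
        unfolding set_lebesgue_integral_def
        by (rule Bochner_Integration.integral_cong) (auto simp: indicator_def)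
      also have "\<dots> = 0"
      proof (cases "max c x \<le> d")
        case True
        have "(LBINT y:{max c x<..<d}. u y - C) =
            (LBINT y:{max c x<..<d}. u y) - (LBINT y:{max c x<..<d}. C)"
          by (rule set_integral_diff) (use i[of "max c x" d] const in auto)
        then show ?thesis using C[of "max c x" d] cd True by (simp add: set_lebesgue_integral_def)
      next
        case False
        then have "{max c x<..<d} = {}" by auto
        then show ?thesis by (simp only: set_lebesgue_integral_def) simp
      qed
      finally show "(LBINT y:{x<..}. ?v y) = 0" .
    qed
    then show ?thesis by eventually_elim (auto simp: indicator_def)
  qed
  \<comment> \<open>The exceptional null set depends on the subinterval, so (a,b) is exhausted by
    countably many of them.\<close>
  have "AE x in lborel. \<forall>n. x \<in> {a + 1 / Suc n<..<b - 1 / Suc n} \<longrightarrow> u x = C"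
    unfolding AE_all_countable by (intro allI AE) auto
  then have "AE x in lborel. x \<in> {a<..<b} \<longrightarrow> u x = C"
  proof eventually_elim
    case (elim x)
    show ?case
    proof
      assume x: "x \<in> {a<..<b}"
      then obtain n where "1 / Suc n < min (x - a) (b - x)"
        using nat_approx_posE[of "min (x - a) (b - x)"] by auto
      then show "u x = C" using elim[rule_format, of n] by auto
    qed
  qed
  then show thesis by (rule that)
qed

section \<open>Distribution functions and weak derivatives\<close>

lemma test_funE:
  assumes "a < b" and \<phi>: "test_fun a b \<phi>"
  obtains c d where "a < c" "c \<le> d" "d < b"
    "\<And>x. (\<phi> has_real_derivative deriv \<phi> x) (at x)" "continuous_on UNIV (deriv \<phi>)"
    "\<And>x. x \<notin> {c..d} \<Longrightarrow> \<phi> x = 0" "\<And>x. x \<notin> {c..d} \<Longrightarrow> deriv \<phi> x = 0"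
proof -
  let ?K = "closure {x. \<phi> x \<noteq> 0}"
  have diff: "(deriv ^^ n) \<phi> differentiable_on UNIV" for n
    using \<phi> by (simp add: test_fun_def)
  have der: "(\<phi> has_real_derivative deriv \<phi> x) (at x)" for x
    using diff[of 0] by (metis DERIV_deriv_iff_real_differentiable UNIV_I differentiable_on_def
        eq_id_iff funpow_0)
  have cont: "continuous_on UNIV (deriv \<phi>)"
    using diff[of 1] by (simp add: differentiable_imp_continuous_on)
  have K: "compact ?K" "?K \<subseteq> {a<..<b}"
    using \<phi> by (auto simp: test_fun_def)
  obtain c d where cd: "a < c" "c \<le> d" "d < b" "?K \<subseteq> {c..d}"
  proof (cases "?K = {}")
    case True
    \<comment> \<open>The zero function has empty support; any interior point will do, here the
      midpoint.\<close>
    show thesis by (rule that[of "(a + b) / 2" "(a + b) / 2"]) (use \<open>a < b\<close> True in auto)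
  next
    case False
    obtain c where c: "c \<in> ?K" "\<And>x. x \<in> ?K \<Longrightarrow> c \<le> x"
      using compact_attains_inf[OF K(1) False] by blast
    obtain d where d: "d \<in> ?K" "\<And>x. x \<in> ?K \<Longrightarrow> x \<le> d"
      using compact_attains_sup[OF K(1) False] by blast
    show thesis
      by (rule that[of c d]) (use c d K(2) in force)+
  qed
  have zero: "\<phi> x = 0" if "x \<notin> {c..d}" for x
    using cd(4) closure_subset[of "{x. \<phi> x \<noteq> 0}"] that by blast
  have "deriv \<phi> x = 0" if "x \<notin> {c..d}" for x
  proof -
    have "(\<phi> has_real_derivative 0) (at x)"
      by (rule has_field_derivative_transform_within_open[of "\<lambda>x. 0" _ _ "- {c..d}"])
        (use that zero in auto)
    then show ?thesis by (rule DERIV_imp_deriv)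
  qed
  with cd der cont zero show thesis by (intro that)
qed

text \<open>For a measure on (a,b) this is the mass of (a,x], but defined on the whole line, so that
  for a finite measure it is a monotone and hence Borel function there.\<close>

definition cdf_on :: "real measure \<Rightarrow> real \<Rightarrow> real" where
  "cdf_on M x = measure M {y \<in> space M. y \<le> x}"

locale finite_interval_measure = finite_measure M for a b :: real and M :: "real measure" +
  assumes less: "a < b" and sets_M: "sets M = sets (restrict_space borel {a<..<b})"
begin

lemma space_M: "space M = {a<..<b}"
  using sets_eq_imp_space_eq[OF sets_M] by (simp add: space_restrict_space)

lemma borel_measurable_M [measurable (raw)]:
  assumes [measurable]: "f \<in> borel_measurable borel"
  shows "f \<in> borel_measurable M"
proof -
  have "f \<in> borel_measurable (restrict_space borel {a<..<b})"
    by (rule measurable_restrict_space1[OF assms])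
  then show ?thesis by (simp cong: measurable_cong_sets add: sets_M)
qed

lemma cdf_on_mono: "mono (cdf_on M)"
  unfolding cdf_on_def
  by (intro monoI finite_measure_mono) auto

lemma borel_measurable_cdf_on [measurable]: "cdf_on M \<in> borel_measurable borel"
  by (rule borel_measurable_mono[OF cdf_on_mono])

lemma abs_cdf_on_le: "\<bar>cdf_on M x\<bar> \<le> measure M (space M)"
  by (simp add: cdf_on_def bounded_measure)

lemma integrable_mult_cdf_on:
  assumes "integrable lborel p" and [measurable]: "\<gamma> \<in> borel_measurable borel"
  shows "integrable lborel (\<lambda>x. p x * cdf_on M (\<gamma> x))"
proof (rule Bochner_Integration.integrable_bound)
  show "integrable lborel (\<lambda>x. measure M (space M) * p x)"
    using assms by simp
  show "AE x in lborel. norm (p x * cdf_on M (\<gamma> x)) \<le> norm (measure M (space M) * p x)"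
    using abs_cdf_on_le by (intro AE_I2) (auto simp: abs_mult mult.commute intro!: mult_left_mono)
qed (use assms in auto)

text \<open>The substitute for integration by parts: \<open>cdf_on M (\<gamma> x)\<close> is the
  integral over y of the indicator of \<open>y \<le> \<gamma> x\<close>, and Fubini swaps the order.
  The map \<gamma> is kept general because it is the identity for test functions and G(cos \<theta>)
  for Chebyshev coefficients.\<close>

lemma integral_mult_cdf_on:
  assumes p: "integrable lborel p" and [measurable]: "\<gamma> \<in> borel_measurable borel"
  shows "(LBINT x. p x * cdf_on M (\<gamma> x)) = (\<integral>y. (LBINT x. p x * indicator {y..} (\<gamma> x)) \<partial>M)"
proof -
  interpret pair_sigma_finite lborel M by unfold_locales
  have [measurable]: "p \<in> borel_measurable borel" using p by auto
  let ?f = "\<lambda>(x, y). p x * indicator {y..} (\<gamma> x)"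
  have *: "(\<integral>y. r * indicator {y..} (\<gamma> x) \<partial>M) = r * cdf_on M (\<gamma> x)" for r x
  proof -
    have "(\<integral>y. r * indicator {y..} (\<gamma> x) \<partial>M) =
        r * (\<integral>y. indicator {y \<in> space M. y \<le> \<gamma> x} y \<partial>M)"
      by (subst integral_mult_right_zero[symmetric], rule Bochner_Integration.integral_cong)
        (auto simp: indicator_def)
    moreover have "{y \<in> space M. y \<le> \<gamma> x} \<inter> space M = {y \<in> space M. y \<le> \<gamma> x}" by auto
    ultimately show ?thesis by (simp add: cdf_on_def)
  qed
  have "integrable (lborel \<Otimes>\<^sub>M M) ?f"
  proof (rule Fubini_integrable)
    show "?f \<in> borel_measurable (lborel \<Otimes>\<^sub>M M)"
    proof -
      have [measurable]: "snd \<in> borel_measurable (lborel \<Otimes>\<^sub>M M)"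
        using measurable_compose[OF measurable_snd borel_measurable_M[of "\<lambda>y. y"]]
        by simp
      have "(\<lambda>z. p (fst z) * (if snd z \<le> \<gamma> (fst z) then 1 else 0)) \<in> borel_measurable (lborel \<Otimes>\<^sub>M M)"
        by measurable
      then show ?thesis by (simp add: case_prod_beta' indicator_def of_bool_def)
    qed
    have "norm (?f (x, y)) = \<bar>p x\<bar> * indicator {y..} (\<gamma> x)" for x y
      by (simp add: abs_mult indicator_def)
    then have "(\<lambda>x. \<integral>y. norm (?f (x, y)) \<partial>M) = (\<lambda>x. \<bar>p x\<bar> * cdf_on M (\<gamma> x))"
      by (simp only: *)
    then show "integrable lborel (\<lambda>x. \<integral>y. norm (?f (x, y)) \<partial>M)"
      using p by (simp add: integrable_mult_cdf_on)
    show "AE x in lborel. integrable M (\<lambda>y. ?f (x, y))"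
    proof (rule AE_I2)
      fix x
      show "integrable M (\<lambda>y. ?f (x, y))"
        by (rule integrable_const_bound[of _ "\<bar>p x\<bar>"]) (auto simp: indicator_def)
    qed
  qed
  from Fubini_integral[OF this] show ?thesis by (simp add: *[of 1, simplified])
qed

text \<open>After Fubini the inner integral is that of \<phi>' over [y,b], which equals -\<phi>(y)
  because \<phi> vanishes at b. So the distributional derivative of \<open>cdf_on M\<close> is
  M.\<close>

lemma integral_cdf_on_deriv_test_fun:
  assumes "test_fun a b \<phi>"
  shows "integrable lborel (\<lambda>x. indicator {a<..<b} x * deriv \<phi> x)"
    and "(LBINT x:{a<..<b}. cdf_on M x * deriv \<phi> x) = - (\<integral>y. \<phi> y \<partial>M)"
proof -
  obtain c d where cd: "a < c" "c \<le> d" "d < b"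
    and der: "\<And>x. (\<phi> has_real_derivative deriv \<phi> x) (at x)" and cont: "continuous_on UNIV (deriv \<phi>)"
    and z: "\<And>x. x \<notin> {c..d} \<Longrightarrow> \<phi> x = 0" and z': "\<And>x. x \<notin> {c..d} \<Longrightarrow> deriv \<phi> x = 0"
    using test_funE[OF less assms] by blast
  have "set_integrable lborel {c..d} (deriv \<phi>)"
    by (rule borel_integrable_atLeastAtMost'[OF continuous_on_subset[OF cont]]) auto
  moreover have "(\<lambda>x. indicator {c..d} x *\<^sub>R deriv \<phi> x) = (\<lambda>x. indicator {a<..<b} x * deriv \<phi> x)"
  proof
    show "indicator {c..d} x *\<^sub>R deriv \<phi> x = indicator {a<..<b} x * deriv \<phi> x" for x
      by (cases "x \<in> {c..d}") (use cd z' in auto)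
  qed
  ultimately show int: "integrable lborel (\<lambda>x. indicator {a<..<b} x * deriv \<phi> x)"
    by (simp add: set_integrable_def)
  have "(LBINT x:{a<..<b}. cdf_on M x * deriv \<phi> x) =
      (LBINT x. (indicator {a<..<b} x * deriv \<phi> x) * cdf_on M x)"
    by (simp add: set_lebesgue_integral_def mult_ac)
  also have "\<dots> = (\<integral>y. (LBINT x. (indicator {a<..<b} x * deriv \<phi> x) * indicator {y..} x) \<partial>M)"
    by (rule integral_mult_cdf_on[OF int]) simp
  also have "\<dots> = (\<integral>y. - \<phi> y \<partial>M)"
  proof (rule Bochner_Integration.integral_cong[OF refl])
    fix y assume "y \<in> space M"
    then have y: "a < y" "y < b" by (auto simp: space_M)
    have "(LBINT x. (indicator {a<..<b} x * deriv \<phi> x) * indicator {y..} x) =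
        (LBINT x. indicator {y..b} x *\<^sub>R deriv \<phi> x)"
    proof (rule Bochner_Integration.integral_cong[OF refl])
      fix x
      \<comment> \<open>The point b lies in [y,b] but not in (a,b); \<phi>' vanishes there.\<close>
      show "(indicator {a<..<b} x * deriv \<phi> x) * indicator {y..} x = indicator {y..b} x *\<^sub>R deriv \<phi> x"
        by (cases "x = b") (use y cd z'[of b] in \<open>auto simp: indicator_def\<close>)
    qed
    also have "\<dots> = \<phi> b - \<phi> y"
      by (rule integral_FTC_atLeastAtMost)
        (use y der cont in \<open>auto simp: has_real_derivative_iff_has_vector_derivative
          intro: has_vector_derivative_at_within continuous_on_subset\<close>)
    finally show "(LBINT x. (indicator {a<..<b} x * deriv \<phi> x) * indicator {y..} x) = - \<phi> y"
      using z[of b] cd by simp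
  qed
  finally show "(LBINT x:{a<..<b}. cdf_on M x * deriv \<phi> x) = - (\<integral>y. \<phi> y \<partial>M)" by simp
qed

end

text \<open>The difference of h and the two distribution functions has weak derivative zero, so the
  du Bois-Reymond lemma makes it constant.\<close>

lemma AE_eq_cdf_on:
  assumes M: "finite_interval_measure a b M" and N: "finite_interval_measure a b N"
    and h [measurable]: "h \<in> borel_measurable borel"
    and int: "\<And>c d. a < c \<Longrightarrow> d < b \<Longrightarrow> set_integrable lborel {c..d} h"
    and weak: "\<And>\<phi>. test_fun a b \<phi> \<Longrightarrow>
      (LBINT x:{a<..<b}. h x * deriv \<phi> x) = - ((\<integral>x. \<phi> x \<partial>M) - (\<integral>x. \<phi> x \<partial>N))"
  obtains C where "AE x in lborel. x \<in> {a<..<b} \<longrightarrow> h x = C + (cdf_on M x - cdf_on N x)"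
proof -
  interpret M: finite_interval_measure a b M by fact
  interpret N: finite_interval_measure a b N by fact
  let ?u = "\<lambda>x. h x - (cdf_on M x - cdf_on N x)"
  have one: "integrable lborel (indicat_real {c..d})" for c d :: real
    using borel_integrable_atLeastAtMost'[of c d "\<lambda>x. 1::real"] by (simp add: set_integrable_def)
  obtain C where "AE x in lborel. x \<in> {a<..<b} \<longrightarrow> ?u x = C"
  proof (rule du_bois_reymond[OF M.less])
    show "set_integrable lborel {c..d} ?u" if "a < c" "d < b" for c d
      using int[OF that] M.integrable_mult_cdf_on[OF one, of "\<lambda>x. x" c d]
        N.integrable_mult_cdf_on[OF one, of "\<lambda>x. x" c d]
      by (intro set_integral_diff) (auto simp: set_integrable_def)
    fix \<phi> assume \<phi>: "test_fun a b \<phi>"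
    obtain c d where cd: "a < c" "c \<le> d" "d < b"
      and "\<And>x. (\<phi> has_real_derivative deriv \<phi> x) (at x)" and cont: "continuous_on UNIV (deriv \<phi>)"
      and "\<And>x. x \<notin> {c..d} \<Longrightarrow> \<phi> x = 0" and z': "\<And>x. x \<notin> {c..d} \<Longrightarrow> deriv \<phi> x = 0"
      using test_funE[OF M.less \<phi>] by blast
    have [measurable]: "deriv \<phi> \<in> borel_measurable borel"
      by (rule borel_measurable_continuous_onI[OF cont])
    have "bounded (deriv \<phi> ` {c..d})"
      by (intro compact_imp_bounded compact_continuous_image continuous_on_subset[OF cont]) auto
    then obtain B where B: "\<And>x. x \<in> {c..d} \<Longrightarrow> \<bar>deriv \<phi> x\<bar> \<le> B"
      by (metis bounded_real image_eqI)
    \<comment> \<open>Needed to split the integral below. As h is integrable only away from the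
      endpoints, the compact support of \<phi>' has to cut it off.\<close>
    have 1: "set_integrable lborel {a<..<b} (\<lambda>x. h x * deriv \<phi> x)"
      unfolding set_integrable_def
    proof (rule Bochner_Integration.integrable_bound)
      show "integrable lborel (\<lambda>x. B * (indicator {c..d} x * h x))"
        using int[of c d] cd by (simp add: set_integrable_def)
      show "AE x in lborel. norm (indicator {a<..<b} x *\<^sub>R (h x * deriv \<phi> x)) \<le>
          norm (B * (indicator {c..d} x * h x))"
      proof (rule AE_I2)
        fix x
        show "norm (indicator {a<..<b} x *\<^sub>R (h x * deriv \<phi> x)) \<le>
            norm (B * (indicator {c..d} x * h x))"
        proof (cases "x \<in> {c..d}")
          case True
          then have "\<bar>h x\<bar> * \<bar>deriv \<phi> x\<bar> \<le> \<bar>h x\<bar> * \<bar>B\<bar>"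
            using B[of x] by (intro mult_left_mono) auto
          then show ?thesis using True cd by (simp add: abs_mult mult.commute)
        qed (use z' in simp)
      qed
    qed measurable
    have 2: "set_integrable lborel {a<..<b} (\<lambda>x. cdf_on M x * deriv \<phi> x)"
      "set_integrable lborel {a<..<b} (\<lambda>x. cdf_on N x * deriv \<phi> x)"
      using M.integrable_mult_cdf_on[OF M.integral_cdf_on_deriv_test_fun(1)[OF \<phi>], of "\<lambda>x. x"]
        N.integrable_mult_cdf_on[OF M.integral_cdf_on_deriv_test_fun(1)[OF \<phi>], of "\<lambda>x. x"]
      by (simp_all add: set_integrable_def mult_ac)
    show "(LBINT x:{a<..<b}. ?u x * deriv \<phi> x) = 0"
      using weak[OF \<phi>] M.integral_cdf_on_deriv_test_fun(2)[OF \<phi>]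
        N.integral_cdf_on_deriv_test_fun(2)[OF \<phi>] 1 2
      by (simp add: left_diff_distrib set_integral_diff)
  qed measurable
  then show thesis
    by (intro that[of C]) (auto simp: algebra_simps elim!: eventually_mono)
qed

section \<open>Chebyshev coefficients of distribution functions\<close>

text \<open>The inverse of \<open>\<theta> \<mapsto> G(cos \<theta>)\<close>; the clamping only serves to make it continuous on the whole
  line.\<close>

definition angle :: "real \<Rightarrow> real \<Rightarrow> real \<Rightarrow> real" where
  "angle a b y = arccos (max (- 1) (min 1 ((2 * y - a - b) / (b - a))))"

lemma angle_G_map:
  assumes "a < b" "\<theta> \<in> {0..pi}"
  shows "angle a b (G_map a b (cos \<theta>)) = \<theta>"
proof -
  have "(2 * G_map a b (cos \<theta>) - a - b) / (b - a) = cos \<theta>"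
    using assms by (simp add: G_map_def field_simps)
  then show ?thesis
    using assms cos_le_one[of \<theta>] cos_ge_minus_one[of \<theta>]
    by (simp add: angle_def arccos_cos min_absorb2 max_absorb2 del: cos_le_one cos_ge_minus_one)
qed

lemma G_map_cos_angle:
  assumes "a < b" "y \<in> {a..b}"
  shows "G_map a b (cos (angle a b y)) = y"
proof -
  let ?t = "(2 * y - a - b) / (b - a)"
  have "- 1 \<le> ?t" "?t \<le> 1" using assms by (simp_all add: field_simps)
  then have "cos (angle a b y) = ?t" by (simp add: angle_def)
  then show ?thesis using assms by (simp add: G_map_def field_simps)
qed

lemma angle_bounds: "0 \<le> angle a b y" "angle a b y \<le> pi"
  by (auto simp: angle_def max_def min_def intro: arccos_lbound arccos_ubound)

lemma angle_in_open:
  assumes "a < b" "y \<in> {a<..<b}"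
  shows "angle a b y \<in> {0<..<pi}"
proof -
  have "angle a b y \<noteq> 0" "angle a b y \<noteq> pi"
    using G_map_cos_angle[of a b y] assms by (auto simp: G_map_def field_simps)
  then show ?thesis using angle_bounds[of a b y] by simp
qed

lemma G_map_le_iff: "a < b \<Longrightarrow> G_map a b s \<le> G_map a b t \<longleftrightarrow> s \<le> t"
  by (simp add: G_map_def mult_le_cancel_left)

lemma G_map_cos_in_open:
  assumes "a < b" "\<theta> \<in> {0<..<pi}"
  shows "G_map a b (cos \<theta>) \<in> {a<..<b}"
proof -
  have "cos \<theta> < 1" "- 1 < cos \<theta>"
    using assms cos_monotone_0_pi[of 0 \<theta>] cos_monotone_0_pi[of \<theta> pi] by auto
  then have "0 < (b - a) * (cos \<theta> + 1)" "(b - a) * (cos \<theta> + 1) < (b - a) * 2"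
    using assms by (intro mult_pos_pos mult_strict_left_mono; simp)+
  moreover have "G_map a b (cos \<theta>) = a + (b - a) * (cos \<theta> + 1) / 2"
    by (simp add: G_map_def)
  ultimately show ?thesis by simp
qed

text \<open>As G(cos \<theta>) decreases in \<theta>, the region
  \<open>y \<le> G_map a b (cos \<theta>)\<close> from Fubini is an initial interval of
  [0,pi].\<close>

lemma le_G_map_cos_iff:
  assumes "a < b" "y \<in> {a..b}" "\<theta> \<in> {0..pi}"
  shows "y \<le> G_map a b (cos \<theta>) \<longleftrightarrow> \<theta> \<le> angle a b y"
proof -
  have "y \<le> G_map a b (cos \<theta>) \<longleftrightarrow> cos (angle a b y) \<le> cos \<theta>"
    using G_map_le_iff[of a b "cos (angle a b y)" "cos \<theta>"] assms by (simp add: G_map_cos_angle)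
  also have "\<dots> \<longleftrightarrow> \<theta> \<le> angle a b y"
    using assms angle_bounds[of a b y] cos_mono_le_eq[of "angle a b y" \<theta>] by auto
  finally show ?thesis .
qed

lemma continuous_angle: "continuous_on A (angle a b)"
  unfolding angle_def divide_inverse
  by (intro continuous_on_compose2[OF continuous_on_arccos'] continuous_intros) auto

lemma borel_measurable_angle [measurable]: "angle a b \<in> borel_measurable borel"
  by (rule borel_measurable_continuous_onI[OF continuous_angle])

lemma borel_measurable_G_map [measurable]: "G_map a b \<in> borel_measurable borel"
  unfolding G_map_def by measurable

section \<open>Null sets under the substitution x = G(cos \<theta>)\<close>

lemma angle_differentiable_on:
  assumes "a < b" shows "angle a b differentiable_on {a<..<b}"
proof -
  have "(angle a b has_real_derivative inverse (- sqrt (1 - ((2 * y - a - b) / (b - a))\<^sup>2)) * (2 / (b - a)))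
      (at y)" if y: "y \<in> {a<..<b}" for y
  proof (rule has_field_derivative_transform_within_open[of "\<lambda>y. arccos ((2 * y - a - b) / (b - a))" _ _ "{a<..<b}"])
    have "- 1 < (2 * y - a - b) / (b - a)" "(2 * y - a - b) / (b - a) < 1"
      using assms y by (simp_all add: field_simps)
    moreover have "((\<lambda>y. (2 * y - a - b) / (b - a)) has_real_derivative 2 / (b - a)) (at y)"
      by (rule DERIV_cdivide) (auto intro!: derivative_eq_intros)
    ultimately show "((\<lambda>y. arccos ((2 * y - a - b) / (b - a))) has_real_derivative
        inverse (- sqrt (1 - ((2 * y - a - b) / (b - a))\<^sup>2)) * (2 / (b - a))) (at y)"
      by (intro DERIV_chain2[OF DERIV_arccos])
    show "arccos ((2 * x - a - b) / (b - a)) = angle a b x" if "x \<in> {a<..<b}" for x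
    proof -
      have "- 1 < (2 * x - a - b) / (b - a)" "(2 * x - a - b) / (b - a) < 1"
        using assms that by (simp_all add: field_simps)
      then show ?thesis by (simp add: angle_def)
    qed
  qed (use y in auto)
  then show ?thesis
    by (meson differentiable_at_withinI differentiable_on_def real_differentiable_def)
qed

text \<open>The bad set lies in the image of a null set under \<open>angle a b\<close>, and a map
  differentiable on a null set carries it to a null set. This lets almost-everywhere statements in x
  be used in integrals over \<theta>.\<close>

lemma negligible_G_map_cos_vimage:
  assumes "a < b" and AE: "AE x in lebesgue. x \<in> {a<..<b} \<longrightarrow> P x"
  shows "negligible {\<theta> \<in> {0<..<pi}. \<not> P (G_map a b (cos \<theta>))}"
proof -
  let ?S = "{x \<in> {a<..<b}. \<not> P x}"
  have "?S = {x \<in> space lebesgue. \<not> (x \<in> {a<..<b} \<longrightarrow> P x)}" by auto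
  then have "negligible ?S"
    using AE by (simp add: negligible_iff_null_sets completion.AE_iff_null_sets)
  then have "negligible (angle a b ` ?S)"
    by (rule negligible_differentiable_image_negligible[OF order_refl])
      (auto intro: differentiable_on_subset[OF angle_differentiable_on[OF assms(1)]])
  moreover have "{\<theta> \<in> {0<..<pi}. \<not> P (G_map a b (cos \<theta>))} \<subseteq> angle a b ` ?S"
  proof
    fix \<theta> assume "\<theta> \<in> {\<theta> \<in> {0<..<pi}. \<not> P (G_map a b (cos \<theta>))}"
    then show "\<theta> \<in> angle a b ` ?S"
      using G_map_cos_in_open[OF assms(1), of \<theta>] angle_G_map[OF assms(1), of \<theta>]
      by (intro image_eqI[of _ _ "G_map a b (cos \<theta>)"]) auto
  qed
  ultimately show ?thesis by (rule negligible_subset)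
qed

text \<open>No integrability is assumed: a change on a null set does not affect whether a function
  is integrable, and if it is not, both integrals have the default value 0.\<close>

lemma set_lebesgue_integral_spike:
  fixes f g :: "real \<Rightarrow> real"
  assumes "negligible T" "\<And>x. x \<in> S - T \<Longrightarrow> f x = g x"
  shows "(LINT x:S|lebesgue. f x) = (LINT x:S|lebesgue. g x)"
proof -
  have "f absolutely_integrable_on S \<longleftrightarrow> g absolutely_integrable_on S"
    by (rule absolutely_integrable_spike_eq[OF assms(1)]) (use assms(2) in force)
  moreover have "integral S f = integral S g"
    by (rule integral_spike[OF assms(1)]) (use assms(2) in force)
  ultimately show ?thesis
    by (cases "f absolutely_integrable_on S", simp add: set_lebesgue_integral_eq_integral(2))
      (simp add: set_lebesgue_integral_def set_integrable_def not_integrable_integral_eq)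
qed

lemma cheb_coeff_cong_AE:
  assumes "a < b" and "AE x in lebesgue. x \<in> {a<..<b} \<longrightarrow> h x = r x"
  shows "cheb_coeff a b h j = cheb_coeff a b r j"
proof -
  \<comment> \<open>At \<theta> = 0 and \<theta> = pi the point G(cos \<theta>) is an endpoint,
    about which the hypothesis says nothing.\<close>
  let ?N = "{\<theta> \<in> {0<..<pi}. h (G_map a b (cos \<theta>)) \<noteq> r (G_map a b (cos \<theta>))} \<union> {0, pi}"
  have "negligible ?N"
    using negligible_G_map_cos_vimage[OF assms] by (simp add: negligible_Un)
  then have "(LINT \<theta>:{0..pi}|lebesgue. h (G_map a b (cos \<theta>)) * cos (real j * \<theta>)) =
      (LINT \<theta>:{0..pi}|lebesgue. r (G_map a b (cos \<theta>)) * cos (real j * \<theta>))"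
    by (rule set_lebesgue_integral_spike) (auto simp: less_eq_real_def)
  then show ?thesis by (simp add: cheb_coeff_cos)
qed

lemma cheb_coeff_borel:
  assumes [measurable]: "r \<in> borel_measurable borel"
  shows "cheb_coeff a b r j =
    2 / pi * (LBINT \<theta>. (indicator {0..pi} \<theta> * cos (real j * \<theta>)) * r (G_map a b (cos \<theta>)))"
proof -
  have "(\<lambda>\<theta>. indicator {0..pi} \<theta> *\<^sub>R (r (G_map a b (cos \<theta>)) * cos (real j * \<theta>))) \<in> borel_measurable borel"
    by measurable
  then have "(LINT \<theta>:{0..pi}|lebesgue. r (G_map a b (cos \<theta>)) * cos (real j * \<theta>)) =
      (LBINT \<theta>. indicator {0..pi} \<theta> *\<^sub>R (r (G_map a b (cos \<theta>)) * cos (real j * \<theta>)))"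
    unfolding set_lebesgue_integral_def by (intro integral_completion) simp
  then show ?thesis by (simp add: cheb_coeff_cos mult_ac)
qed

section \<open>Chebyshev coefficients as sine integrals against the derivative\<close>

lemma integrable_cos_indicator: "integrable lborel (\<lambda>\<theta>. indicator {0..t} \<theta> * cos (real j * \<theta>))"
  using borel_integrable_atLeastAtMost'[of 0 t "\<lambda>\<theta>. cos (real j * \<theta>)"]
  by (simp add: set_integrable_def continuous_intros)

lemma integral_cos_indicator:
  assumes "0 \<le> t" "0 < j"
  shows "(LBINT \<theta>. indicator {0..t} \<theta> * cos (real j * \<theta>)) = sin (real j * t) / real j"
proof -
  have "(LBINT \<theta>. indicator {0..t} \<theta> *\<^sub>R cos (real j * \<theta>)) = sin (real j * t) / real j - sin (real j * 0) / real j"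
    by (rule integral_FTC_atLeastAtMost[OF assms(1)])
      (use assms(2) in \<open>auto simp: has_real_derivative_iff_has_vector_derivative[symmetric]
        intro!: derivative_eq_intros continuous_intros\<close>)
  then show ?thesis by simp
qed

text \<open>After Fubini the inner integral is that of cos(j\<theta>) over
  [0, \<open>angle a b y\<close>].\<close>

lemma (in finite_interval_measure) integral_cdf_on_cos:
  assumes "0 < j"
  shows "(LBINT \<theta>. (indicator {0..pi} \<theta> * cos (real j * \<theta>)) * cdf_on M (G_map a b (cos \<theta>))) =
    (\<integral>y. sin (real j * angle a b y) \<partial>M) / real j"
proof -
  have "(LBINT \<theta>. (indicator {0..pi} \<theta> * cos (real j * \<theta>)) * cdf_on M (G_map a b (cos \<theta>))) =
      (\<integral>y. (LBINT \<theta>. (indicator {0..pi} \<theta> * cos (real j * \<theta>)) * indicator {y..} (G_map a b (cos \<theta>))) \<partial>M)"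
    by (rule integral_mult_cdf_on[OF integrable_cos_indicator]) measurable
  also have "\<dots> = (\<integral>y. sin (real j * angle a b y) / real j \<partial>M)"
  proof (rule Bochner_Integration.integral_cong[OF refl])
    fix y assume "y \<in> space M"
    then have y: "y \<in> {a..b}" by (auto simp: space_M)
    have eq: "(indicator {0..pi} \<theta> * cos (real j * \<theta>)) * indicator {y..} (G_map a b (cos \<theta>)) =
        indicator {0..angle a b y} \<theta> * cos (real j * \<theta>)" for \<theta>
      using le_G_map_cos_iff[OF less y, of \<theta>] angle_bounds[of a b y] by (auto simp: indicator_def)
    show "(LBINT \<theta>. (indicator {0..pi} \<theta> * cos (real j * \<theta>)) * indicator {y..} (G_map a b (cos \<theta>))) =
        sin (real j * angle a b y) / real j"
      by (simp only: eq integral_cos_indicator[OF angle_bounds(1) assms])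
  qed
  finally show ?thesis by simp
qed

lemma cheb_coeff_cdf_on:
  assumes M: "finite_interval_measure a b M" and N: "finite_interval_measure a b N"
    and h: "AE x in lebesgue. x \<in> {a<..<b} \<longrightarrow> h x = C + (cdf_on M x - cdf_on N x)" and "0 < j"
  shows "cheb_coeff a b h j =
    2 / (pi * real j) * ((\<integral>y. sin (real j * angle a b y) \<partial>M) - (\<integral>y. sin (real j * angle a b y) \<partial>N))"
proof -
  interpret M: finite_interval_measure a b M by fact
  interpret N: finite_interval_measure a b N by fact
  let ?p = "\<lambda>\<theta>. indicator {0..pi} \<theta> * cos (real j * \<theta>)" and ?\<gamma> = "\<lambda>\<theta>. G_map a b (cos \<theta>)"
  have p: "integrable lborel ?p" by (rule integrable_cos_indicator)
  have "cheb_coeff a b h j = cheb_coeff a b (\<lambda>x. C + (cdf_on M x - cdf_on N x)) j"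
    by (rule cheb_coeff_cong_AE[OF M.less h])
  also have "\<dots> = 2 / pi * (LBINT \<theta>. ?p \<theta> * (C + (cdf_on M (?\<gamma> \<theta>) - cdf_on N (?\<gamma> \<theta>))))"
    by (rule cheb_coeff_borel) measurable
  also have "(LBINT \<theta>. ?p \<theta> * (C + (cdf_on M (?\<gamma> \<theta>) - cdf_on N (?\<gamma> \<theta>)))) =
      (LBINT \<theta>. ?p \<theta> * C + (?p \<theta> * cdf_on M (?\<gamma> \<theta>) - ?p \<theta> * cdf_on N (?\<gamma> \<theta>)))"
    by (simp only: distrib_left right_diff_distrib)
  also have "\<dots> = (LBINT \<theta>. ?p \<theta> * C) + ((LBINT \<theta>. ?p \<theta> * cdf_on M (?\<gamma> \<theta>)) - (LBINT \<theta>. ?p \<theta> * cdf_on N (?\<gamma> \<theta>)))"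
  proof -
    have "integrable lborel (\<lambda>\<theta>. ?p \<theta> * C)" using p by (rule integrable_mult_left)
    moreover have "integrable lborel (\<lambda>\<theta>. ?p \<theta> * cdf_on M (?\<gamma> \<theta>))"
      by (rule M.integrable_mult_cdf_on[OF p]) measurable
    moreover have "integrable lborel (\<lambda>\<theta>. ?p \<theta> * cdf_on N (?\<gamma> \<theta>))"
      by (rule N.integrable_mult_cdf_on[OF p]) measurable
    ultimately show ?thesis
      by (simp only: Bochner_Integration.integral_add Bochner_Integration.integral_diff
          Bochner_Integration.integrable_diff)
  qed
  \<comment> \<open>The unknown constant drops out because sin(j pi) = 0; this needs j > 0.\<close>
  also have "(LBINT \<theta>. ?p \<theta> * C) = 0"
    using integral_cos_indicator[of pi j] \<open>0 < j\<close> by simp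
  finally show ?thesis
    unfolding M.integral_cdf_on_cos[OF \<open>0 < j\<close>] N.integral_cdf_on_cos[OF \<open>0 < j\<close>]
    using \<open>0 < j\<close> by (simp add: field_simps)
qed

lemma (in finite_measure) abs_integral_le_measure:
  assumes "\<And>x. \<bar>f x\<bar> \<le> (1::real)"
  shows "\<bar>\<integral>x. f x \<partial>M\<bar> \<le> measure M (space M)"
proof (cases "integrable M f")
  case True
  have "\<bar>\<integral>x. f x \<partial>M\<bar> \<le> (\<integral>x. \<bar>f x\<bar> \<partial>M)"
    using integral_norm_bound[of M f] by simp
  also have "\<dots> \<le> (\<integral>x. 1 \<partial>M)"
    by (rule integral_mono) (use True assms in auto)
  finally show ?thesis by simp
qed (simp add: not_integrable_integral_eq)

lemma abs_cheb_coeff_le: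
  assumes M: "finite_interval_measure a b M" and N: "finite_interval_measure a b N"
    and h: "AE x in lebesgue. x \<in> {a<..<b} \<longrightarrow> h x = C + (cdf_on M x - cdf_on N x)" and "0 < j"
  shows "\<bar>cheb_coeff a b h j\<bar> \<le> 2 / (pi * real j) * (measure M (space M) + measure N (space N))"
proof -
  interpret M: finite_interval_measure a b M by fact
  interpret N: finite_interval_measure a b N by fact
  have "\<bar>(\<integral>y. sin (real j * angle a b y) \<partial>M) - (\<integral>y. sin (real j * angle a b y) \<partial>N)\<bar> \<le>
      measure M (space M) + measure N (space N)"
    using M.abs_integral_le_measure[of "\<lambda>y. sin (real j * angle a b y)"]
      N.abs_integral_le_measure[of "\<lambda>y. sin (real j * angle a b y)"] by (simp add: abs_sin_le_one)
  then show ?thesis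
    unfolding cheb_coeff_cdf_on[OF assms] abs_mult
    using \<open>0 < j\<close> by (intro mult_mono) auto
qed

section \<open>Weak derivatives that are finite measures\<close>

text \<open>Measurability of h is known only on compact subintervals. Cutting h off to an exhausting
  sequence of them and passing to the pointwise limit gives a Lebesgue measurable function on the
  line, which agrees with a Borel function almost everywhere.\<close>

lemma loc_integrable_borel_rep:
  assumes "loc_integrable a b h"
  obtains r where "r \<in> borel_measurable borel" "AE x in lebesgue. x \<in> {a<..<b} \<longrightarrow> h x = r x"
    "\<And>c d. a < c \<Longrightarrow> d < b \<Longrightarrow> set_integrable lborel {c..d} r"
proof -
  have int: "set_integrable lebesgue {c..d} h" if "a < c" "d < b" for c d
    using assms that by (cases "c \<le> d") (auto simp: loc_integrable_def set_integrable_def)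
  have meas: "(\<lambda>x. indicator {c..d} x * h x) \<in> borel_measurable lebesgue" if "a < c" "d < b" for c d
    using int[OF that] by (simp add: set_integrable_def)
  let ?c = "\<lambda>n. a + 1 / real (Suc n)" and ?d = "\<lambda>n. b - 1 / real (Suc n)"
  have "(\<lambda>x. indicator {a<..<b} x * h x) \<in> borel_measurable lebesgue"
  proof (rule borel_measurable_LIMSEQ_real)
    show "(\<lambda>x. indicator {?c n..?d n} x * h x) \<in> borel_measurable lebesgue" for n
      by (rule meas) auto
    fix x
    have "(\<lambda>n. indicator {?c n..?d n} x :: real) \<longlonglongrightarrow> indicator {a<..<b} x"
    proof (cases "x \<in> {a<..<b}")
      case True
      have "?c \<longlonglongrightarrow> a + 0" "?d \<longlonglongrightarrow> b - 0"
        by (intro tendsto_intros LIMSEQ_Suc[OF lim_1_over_n])+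
      then have "\<forall>\<^sub>F n in sequentially. ?c n < x" "\<forall>\<^sub>F n in sequentially. x < ?d n"
        using True by (auto intro: order_tendstoD)
      then have "\<forall>\<^sub>F n in sequentially. indicator {a<..<b} x = (indicator {?c n..?d n} x :: real)"
        by eventually_elim (use True in auto)
      then show ?thesis by (rule Lim_transform_eventually[OF tendsto_const])
    next
      case False
      have "x \<notin> {?c n..?d n}" for n
      proof
        assume "x \<in> {?c n..?d n}"
        moreover have "0 < 1 / real (Suc n)" by simp
        ultimately show False using False unfolding atLeastAtMost_iff greaterThanLessThan_iff by linarith
      qed
      then show ?thesis using False by simp
    qed
    then show "(\<lambda>n. indicator {?c n..?d n} x * h x) \<longlonglongrightarrow> indicator {a<..<b} x * h x"
      by (rule tendsto_mult_right)
  qed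
  then obtain r where r: "r \<in> borel_measurable borel"
    and "AE x in lborel. indicator {a<..<b} x * h x = r x"
    using completion_ex_borel_measurable_real[of _ lborel] by auto
  then have AE: "AE x in lebesgue. x \<in> {a<..<b} \<longrightarrow> h x = r x"
    by (auto intro!: AE_completion elim!: eventually_mono)
  have [measurable]: "r \<in> borel_measurable borel" by (rule r)
  have "set_integrable lborel {c..d} r" if cd: "a < c" "d < b" for c d
  proof -
    have "integrable lebesgue (\<lambda>x. indicator {c..d} x * r x) \<longleftrightarrow>
        integrable lebesgue (\<lambda>x. indicator {c..d} x * h x)"
    proof (rule integrable_cong_AE)
      show "AE x in lebesgue. indicator {c..d} x * r x = indicator {c..d} x * h x"
        using AE by eventually_elim (use cd in \<open>auto simp: indicator_def\<close>)
    qed (use meas[OF cd] in \<open>auto intro!: measurable_completion\<close>)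
    then have "integrable lebesgue (\<lambda>x. indicator {c..d} x * r x)"
      using int[OF cd] by (simp add: set_integrable_def)
    then show ?thesis
      by (simp add: set_integrable_def integrable_completion)
  qed
  with r AE show thesis by (rule that)
qed

lemma set_lebesgue_integral_cong_null:
  fixes f g p :: "real \<Rightarrow> real"
  assumes "AE x in lebesgue. x \<in> S \<longrightarrow> f x = g x"
  shows "(LINT x:S|lebesgue. f x * p x) = (LINT x:S|lebesgue. g x * p x)"
proof (rule set_lebesgue_integral_spike)
  have "{x \<in> S. f x \<noteq> g x} = {x \<in> space lebesgue. \<not> (x \<in> S \<longrightarrow> f x = g x)}" by auto
  then show "negligible {x \<in> S. f x \<noteq> g x}"
    using assms by (simp add: negligible_iff_null_sets completion.AE_iff_null_sets)
qed auto

lemma set_lebesgue_integral_borel: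
  fixes f :: "real \<Rightarrow> real"
  assumes [measurable]: "f \<in> borel_measurable borel" "S \<in> sets borel"
  shows "(LINT x:S|lebesgue. f x) = (LBINT x:S. f x)"
  unfolding set_lebesgue_integral_def by (rule integral_completion) measurable

text \<open>The common form of both branches of \<open>T_norm\<close>: the derivative is a
  difference of two finite measures, be they the parts of a density or a Jordan pair.\<close>

definition weak_deriv_finite ::
  "real \<Rightarrow> real \<Rightarrow> (real \<Rightarrow> real) \<Rightarrow> real measure \<Rightarrow> real measure \<Rightarrow> bool" where
  "weak_deriv_finite a b h M N \<longleftrightarrow>
     finite_interval_measure a b M \<and> finite_interval_measure a b N \<and> loc_integrable a b h \<and>
     (\<forall>\<phi>. test_fun a b \<phi> \<longrightarrow>
        (LINT x:{a<..<b}|lebesgue. h x * deriv \<phi> x) = - ((LINT x|M. \<phi> x) - (LINT x|N. \<phi> x)))"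

lemma weak_deriv_finite_AE_eq:
  assumes "weak_deriv_finite a b h M N"
  obtains C where "AE x in lebesgue. x \<in> {a<..<b} \<longrightarrow> h x = C + (cdf_on M x - cdf_on N x)"
proof -
  have M: "finite_interval_measure a b M" and N: "finite_interval_measure a b N"
    and "loc_integrable a b h"
    and w: "\<And>\<phi>. test_fun a b \<phi> \<Longrightarrow>
        (LINT x:{a<..<b}|lebesgue. h x * deriv \<phi> x) = - ((LINT x|M. \<phi> x) - (LINT x|N. \<phi> x))"
    using assms by (auto simp: weak_deriv_finite_def)
  then obtain r where r [measurable]: "r \<in> borel_measurable borel"
    and AE: "AE x in lebesgue. x \<in> {a<..<b} \<longrightarrow> h x = r x"
    and int: "\<And>c d. a < c \<Longrightarrow> d < b \<Longrightarrow> set_integrable lborel {c..d} r"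
    using loc_integrable_borel_rep by blast
  have less: "a < b" using M by (rule finite_interval_measure.less)
  obtain C where "AE x in lborel. x \<in> {a<..<b} \<longrightarrow> r x = C + (cdf_on M x - cdf_on N x)"
  proof (rule AE_eq_cdf_on[OF M N r int])
    fix \<phi> assume \<phi>: "test_fun a b \<phi>"
    obtain c d where "a < c" "c \<le> d" "d < b"
      "\<And>x. (\<phi> has_real_derivative deriv \<phi> x) (at x)" and cont: "continuous_on UNIV (deriv \<phi>)"
      and "\<And>x. x \<notin> {c..d} \<Longrightarrow> \<phi> x = 0" "\<And>x. x \<notin> {c..d} \<Longrightarrow> deriv \<phi> x = 0"
      using test_funE[OF less \<phi>] by blast
    have [measurable]: "deriv \<phi> \<in> borel_measurable borel"
      by (rule borel_measurable_continuous_onI[OF cont])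
    have "(LBINT x:{a<..<b}. r x * deriv \<phi> x) = (LINT x:{a<..<b}|lebesgue. r x * deriv \<phi> x)"
      by (rule set_lebesgue_integral_borel[symmetric]) measurable
    also have "\<dots> = (LINT x:{a<..<b}|lebesgue. h x * deriv \<phi> x)"
      by (rule set_lebesgue_integral_cong_null[OF AE, symmetric])
    finally show "(LBINT x:{a<..<b}. r x * deriv \<phi> x) = - ((LINT x|M. \<phi> x) - (LINT x|N. \<phi> x))"
      using w[OF \<phi>] by simp
  qed auto
  then have "AE x in lebesgue. x \<in> {a<..<b} \<longrightarrow> r x = C + (cdf_on M x - cdf_on N x)"
    by (rule AE_completion)
  with AE have "AE x in lebesgue. x \<in> {a<..<b} \<longrightarrow> h x = C + (cdf_on M x - cdf_on N x)"
    by eventually_elim auto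
  then show thesis by (rule that)
qed

lemma finite_interval_measure_density:
  fixes p :: "real \<Rightarrow> real"
  assumes "a < b" and p [measurable]: "p \<in> borel_measurable borel" and nonneg: "\<And>x. 0 \<le> p x"
    and int: "set_integrable lborel {a<..<b} p"
  defines "M \<equiv> restrict_space (density lborel p) {a<..<b}"
  shows "finite_interval_measure a b M"
    and "f \<in> borel_measurable borel \<Longrightarrow> (\<integral>x. f x \<partial>M) = (LBINT x:{a<..<b}. p x * f x)"
    and "measure M (space M) = (LBINT x:{a<..<b}. p x)"
proof -
  have i: "integrable lborel (\<lambda>x. p x * indicator {a<..<b} x)"
    using int by (simp add: set_integrable_def mult.commute)
  have "emeasure M (space M) = (\<integral>\<^sup>+x. ennreal (p x) * indicator {a<..<b} x \<partial>lborel)"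
    unfolding M_def by (simp add: emeasure_restrict_space space_restrict_space emeasure_density)
  also have "\<dots> = (\<integral>\<^sup>+x. ennreal (p x * indicator {a<..<b} x) \<partial>lborel)"
    by (rule nn_integral_cong) (auto simp: indicator_def)
  also have "\<dots> < \<infinity>"
    using i nonneg by (simp add: integrable_iff_bounded abs_mult)
  finally have "emeasure M (space M) \<noteq> \<infinity>" by simp
  then interpret finite_measure M by (rule finite_measureI)
  show "finite_interval_measure a b M"
  proof
    show "sets M = sets (restrict_space borel {a<..<b})"
      unfolding M_def by (simp add: sets_restrict_space)
  qed fact
  show f: "(\<integral>x. f x \<partial>M) = (LBINT x:{a<..<b}. p x * f x)"
    if [measurable]: "f \<in> borel_measurable borel" for f
    using nonneg unfolding M_def set_lebesgue_integral_def
    by (subst integral_restrict_space) (auto simp: integral_density mult_ac set_lebesgue_integral_def)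
  show "measure M (space M) = (LBINT x:{a<..<b}. p x)"
    using f[of "\<lambda>x. 1"] by simp
qed

lemma set_integrable_mult_bounded:
  fixes g f :: "real \<Rightarrow> real"
  assumes int: "set_integrable lborel S g"
    and [measurable]: "g \<in> borel_measurable borel" "f \<in> borel_measurable borel" "S \<in> sets borel"
    and bound: "\<And>x. \<bar>f x\<bar> \<le> B"
  shows "set_integrable lborel S (\<lambda>x. g x * f x)"
  unfolding set_integrable_def
proof (rule Bochner_Integration.integrable_bound)
  show "integrable lborel (\<lambda>x. (indicator S x *\<^sub>R g x) * B)"
    using int unfolding set_integrable_def by (rule integrable_mult_left)
  show "AE x in lborel. norm (indicator S x *\<^sub>R (g x * f x)) \<le> norm ((indicator S x *\<^sub>R g x) * B)"
  proof (rule AE_I2)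
    fix x
    have "\<bar>f x\<bar> \<le> \<bar>B\<bar>" using bound[of x] by linarith
    then show "norm (indicator S x *\<^sub>R (g x * f x)) \<le> norm ((indicator S x *\<^sub>R g x) * B)"
      by (auto simp: abs_mult mult.assoc intro!: mult_left_mono)
  qed
qed measurable

text \<open>The two measures have the positive and the negative part of r as densities, so their
  difference recombines to r and their sum to \<open>\<bar>r x\<bar>\<close>. Boundedness of f keeps
  both integrals finite, which the recombination requires.\<close>

lemma weak_deriv_imp_finite:
  assumes less: "a < b" and weak: "weak_deriv a b h g" and r [measurable]: "r \<in> borel_measurable borel"
    and AE: "AE x in lebesgue. x \<in> {a<..<b} \<longrightarrow> g x = r x"
    and int: "set_integrable lborel {a<..<b} r"
  obtains M N where "weak_deriv_finite a b h M N"
    "\<And>f B. f \<in> borel_measurable borel \<Longrightarrow> (\<And>x. \<bar>f x\<bar> \<le> B) \<Longrightarrow>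
      (\<integral>x. f x \<partial>M) - (\<integral>x. f x \<partial>N) = (LBINT x:{a<..<b}. r x * f x)"
    "measure M (space M) + measure N (space N) = (LBINT x:{a<..<b}. \<bar>r x\<bar>)"
proof -
  let ?p = "\<lambda>x. max 0 (r x)" and ?n = "\<lambda>x. max 0 (- r x)"
  have ip: "set_integrable lborel {a<..<b} ?p" and "in": "set_integrable lborel {a<..<b} ?n"
    by (rule set_integrable_bound[OF int], auto simp: set_borel_measurable_def)+
  define M where "M = restrict_space (density lborel ?p) {a<..<b}"
  define N where "N = restrict_space (density lborel ?n) {a<..<b}"
  have p: "?p \<in> borel_measurable borel" "\<And>x. 0 \<le> ?p x" and n: "?n \<in> borel_measurable borel" "\<And>x. 0 \<le> ?n x"
    by auto
  note M = finite_interval_measure_density[OF less p ip, folded M_def]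
  note N = finite_interval_measure_density[OF less n "in", folded N_def]
  have diff: "(\<integral>x. f x \<partial>M) - (\<integral>x. f x \<partial>N) = (LBINT x:{a<..<b}. r x * f x)"
    if [measurable]: "f \<in> borel_measurable borel" and B: "\<And>x. \<bar>f x\<bar> \<le> B" for f B
  proof -
    have "(\<integral>x. f x \<partial>M) - (\<integral>x. f x \<partial>N) = (LBINT x:{a<..<b}. ?p x * f x - ?n x * f x)"
      using M(2)[of f] N(2)[of f] that
        set_integrable_mult_bounded[OF ip p(1) that(1) _ B] set_integrable_mult_bounded[OF "in" n(1) that(1) _ B]
      by (simp add: set_integral_diff)
    also have "(\<lambda>x. ?p x * f x - ?n x * f x) = (\<lambda>x. r x * f x)"
      by (auto simp: max_def)
    finally show ?thesis .
  qed
  have "measure M (space M) + measure N (space N) = (LBINT x:{a<..<b}. ?p x + ?n x)"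
    using M(3) N(3) ip "in" by (simp add: set_integral_add)
  also have "(\<lambda>x. ?p x + ?n x) = (\<lambda>x. \<bar>r x\<bar>)"
    by (auto simp: max_def)
  finally have mass: "measure M (space M) + measure N (space N) = (LBINT x:{a<..<b}. \<bar>r x\<bar>)" .
  have "weak_deriv_finite a b h M N"
    unfolding weak_deriv_finite_def
  proof (intro conjI allI impI M(1) N(1))
    show "loc_integrable a b h" using weak by (simp add: weak_deriv_def)
    fix \<phi> assume \<phi>: "test_fun a b \<phi>"
    obtain c d where "a < c" "c \<le> d" "d < b"
      and der: "\<And>x. (\<phi> has_real_derivative deriv \<phi> x) (at x)" and "continuous_on UNIV (deriv \<phi>)"
      and z: "\<And>x. x \<notin> {c..d} \<Longrightarrow> \<phi> x = 0" and "\<And>x. x \<notin> {c..d} \<Longrightarrow> deriv \<phi> x = 0"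
      using test_funE[OF less \<phi>] by blast
    have cont: "continuous_on A \<phi>" for A
      using der by (meson DERIV_isCont continuous_at_imp_continuous_on)
    have [measurable]: "\<phi> \<in> borel_measurable borel"
      by (rule borel_measurable_continuous_onI[OF cont])
    have "bounded (\<phi> ` {c..d})"
      by (intro compact_imp_bounded compact_continuous_image cont) auto
    then obtain B where B: "\<And>x. x \<in> {c..d} \<Longrightarrow> \<bar>\<phi> x\<bar> \<le> B"
      by (metis bounded_real image_eqI)
    have B': "\<bar>\<phi> x\<bar> \<le> max B 0" for x
      using B[of x] z[of x] by (cases "x \<in> {c..d}") auto
    have "(LINT x:{a<..<b}|lebesgue. g x * \<phi> x) = (LINT x:{a<..<b}|lebesgue. r x * \<phi> x)"
      by (rule set_lebesgue_integral_cong_null[OF AE])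
    also have "\<dots> = (LBINT x:{a<..<b}. r x * \<phi> x)"
      by (rule set_lebesgue_integral_borel) measurable
    also have "\<dots> = (LINT x|M. \<phi> x) - (LINT x|N. \<phi> x)"
      by (rule diff[OF _ B', symmetric]) measurable
    finally show "(LINT x:{a<..<b}|lebesgue. h x * deriv \<phi> x) = - ((LINT x|M. \<phi> x) - (LINT x|N. \<phi> x))"
      using weak \<phi> by (simp add: weak_deriv_def)
  qed
  then show thesis using diff mass by (rule that)
qed

section \<open>The weighted norm controls the total mass\<close>

lemma change_of_variables_G_map_cos:
  fixes f :: "real \<Rightarrow> real"
  assumes less: "a < b"
  shows "(\<lambda>\<theta>. ((b - a) / 2 * sin \<theta>) * f (G_map a b (cos \<theta>))) absolutely_integrable_on {0<..<pi} \<and>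
      integral {0<..<pi} (\<lambda>\<theta>. ((b - a) / 2 * sin \<theta>) * f (G_map a b (cos \<theta>))) = I \<longleftrightarrow>
    f absolutely_integrable_on {a<..<b} \<and> integral {a<..<b} f = I"
proof -
  let ?G = "\<lambda>\<theta>. G_map a b (cos \<theta>)"
  have im: "?G ` {0<..<pi} = {a<..<b}"
  proof (intro equalityI subsetI)
    fix y assume "y \<in> {a<..<b}"
    then show "y \<in> ?G ` {0<..<pi}"
      using angle_in_open[OF less, of y] G_map_cos_angle[OF less, of y]
      by (intro image_eqI[of _ _ "angle a b y"]) auto
  qed (use G_map_cos_in_open[OF less] in blast)
  have inj: "inj_on ?G {0<..<pi}"
    by (rule inj_on_inverseI[of _ "angle a b"]) (simp add: angle_G_map[OF less])
  have der: "(?G has_field_derivative - ((b - a) / 2 * sin \<theta>)) (at \<theta> within {0<..<pi})" for \<theta>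
    unfolding G_map_def by (auto intro!: derivative_eq_intros)
  \<comment> \<open>The map decreases and sin \<theta> is positive inside (0,pi), so this is the
    Jacobian factor.\<close>
  have abs: "\<bar>- ((b - a) / 2 * sin \<theta>)\<bar> = (b - a) / 2 * sin \<theta>" if "\<theta> \<in> {0<..<pi}" for \<theta>
    using less that sin_gt_zero[of \<theta>] by (simp add: abs_mult)
  have "(\<lambda>\<theta>. \<bar>- ((b - a) / 2 * sin \<theta>)\<bar> * f (?G \<theta>)) absolutely_integrable_on {0<..<pi} \<longleftrightarrow>
      (\<lambda>\<theta>. ((b - a) / 2 * sin \<theta>) * f (?G \<theta>)) absolutely_integrable_on {0<..<pi}"
    by (rule set_integrable_cong) (use abs in auto)
  moreover have "integral {0<..<pi} (\<lambda>\<theta>. \<bar>- ((b - a) / 2 * sin \<theta>)\<bar> * f (?G \<theta>)) =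
      integral {0<..<pi} (\<lambda>\<theta>. ((b - a) / 2 * sin \<theta>) * f (?G \<theta>))"
    by (rule integral_cong) (use abs in auto)
  ultimately show ?thesis
    using has_absolute_integral_change_of_variables_1'[of "{0<..<pi}" ?G
        "\<lambda>\<theta>. - ((b - a) / 2 * sin \<theta>)" f I] der inj unfolding im by simp
qed

lemma absolutely_integrable_borel_iff:
  fixes f :: "real \<Rightarrow> real"
  assumes [measurable]: "f \<in> borel_measurable borel" "S \<in> sets borel"
  shows "f absolutely_integrable_on S \<longleftrightarrow> set_integrable lborel S f"
  unfolding set_integrable_def by (rule integrable_completion) measurable

lemma integral_borel_eq:
  fixes f :: "real \<Rightarrow> real"
  assumes [measurable]: "f \<in> borel_measurable borel" "S \<in> sets borel"
    and "set_integrable lborel S f"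
  shows "integral S f = (LBINT x:S. f x)"
  using set_lebesgue_integral_eq_integral(2)[of S f] assms set_lebesgue_integral_borel[of f S]
  by (simp add: absolutely_integrable_borel_iff)

text \<open>Substituting gives dx = (b - a)/2 sin \<theta> d\<theta> up to orientation, and sin
  \<theta> \<le> 1. Hence the plain integral of \<open>\<bar>r x\<bar>\<close> costs a factor (b -
  a)/2 against the norm.\<close>

lemma integrable_on_interval_if_T_norm_finite:
  assumes less: "a < b" and r [measurable]: "r \<in> borel_measurable borel"
    and fin: "(\<integral>\<^sup>+\<theta>\<in>{0..pi}. ennreal \<bar>r (G_map a b (cos \<theta>))\<bar> \<partial>lborel) < \<infinity>"
  shows "set_integrable lborel {a<..<b} r"
    and "(LBINT x:{a<..<b}. \<bar>r x\<bar>) \<le>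
      (b - a) / 2 * enn2real (\<integral>\<^sup>+\<theta>\<in>{0..pi}. ennreal \<bar>r (G_map a b (cos \<theta>))\<bar> \<partial>lborel)"
proof -
  let ?F = "\<lambda>\<theta>. \<bar>r (G_map a b (cos \<theta>))\<bar>" and ?s = "\<lambda>\<theta>. (b - a) / 2 * sin \<theta>"
  have eq: "(\<integral>\<^sup>+\<theta>\<in>{0..pi}. ennreal (?F \<theta>) \<partial>lborel) = (\<integral>\<^sup>+\<theta>. ennreal (indicator {0..pi} \<theta> * ?F \<theta>) \<partial>lborel)"
    by (rule nn_integral_cong) (auto simp: indicator_def)
  have intF: "integrable lborel (\<lambda>\<theta>. indicator {0..pi} \<theta> * ?F \<theta>)"
    using fin unfolding eq by (intro integrableI_nonneg) auto
  have F: "(LBINT \<theta>. indicator {0..pi} \<theta> * ?F \<theta>) =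
      enn2real (\<integral>\<^sup>+\<theta>\<in>{0..pi}. ennreal (?F \<theta>) \<partial>lborel)"
    unfolding eq by (rule integral_eq_nn_integral) auto
  have intsF: "set_integrable lborel {0<..<pi} (\<lambda>\<theta>. ?s \<theta> * ?F \<theta>)"
    unfolding set_integrable_def
  proof (rule Bochner_Integration.integrable_bound)
    show "integrable lborel (\<lambda>\<theta>. (b - a) / 2 * (indicator {0..pi} \<theta> * ?F \<theta>))"
      using intF by (rule integrable_mult_right)
    show "AE \<theta> in lborel. norm (indicator {0<..<pi} \<theta> *\<^sub>R (?s \<theta> * ?F \<theta>)) \<le>
        norm ((b - a) / 2 * (indicator {0..pi} \<theta> * ?F \<theta>))"
      using less by (auto simp: indicator_def abs_mult intro!: AE_I2 mult_left_le_one_le)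
  qed measurable
  then have "(\<lambda>\<theta>. ?s \<theta> * ?F \<theta>) absolutely_integrable_on {0<..<pi}"
    by (subst absolutely_integrable_borel_iff) auto
  then have *: "(\<lambda>x. \<bar>r x\<bar>) absolutely_integrable_on {a<..<b} \<and>
      integral {a<..<b} (\<lambda>x. \<bar>r x\<bar>) = integral {0<..<pi} (\<lambda>\<theta>. ?s \<theta> * ?F \<theta>)"
    using change_of_variables_G_map_cos[OF less, of "\<lambda>x. \<bar>r x\<bar>"] by blast
  then have abs: "set_integrable lborel {a<..<b} (\<lambda>x. \<bar>r x\<bar>)"
    by (subst (asm) absolutely_integrable_borel_iff) auto
  then show "set_integrable lborel {a<..<b} r"
    by (rule set_integrable_bound) (auto simp: set_borel_measurable_def)
  have "(LBINT x:{a<..<b}. \<bar>r x\<bar>) = (LBINT \<theta>:{0<..<pi}. ?s \<theta> * ?F \<theta>)"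
    using * abs intsF integral_borel_eq[of "\<lambda>x. \<bar>r x\<bar>" "{a<..<b}"]
      integral_borel_eq[of "\<lambda>\<theta>. ?s \<theta> * ?F \<theta>" "{0<..<pi}"] by simp
  also have "\<dots> \<le> (LBINT \<theta>. (b - a) / 2 * (indicator {0..pi} \<theta> * ?F \<theta>))"
    unfolding set_lebesgue_integral_def
  proof (rule integral_mono)
    show "integrable lborel (\<lambda>\<theta>. indicator {0<..<pi} \<theta> *\<^sub>R (?s \<theta> * ?F \<theta>))"
      using intsF by (simp add: set_integrable_def)
    show "integrable lborel (\<lambda>\<theta>. (b - a) / 2 * (indicator {0..pi} \<theta> * ?F \<theta>))"
      using intF by (rule integrable_mult_right)
    show "indicator {0<..<pi} \<theta> *\<^sub>R (?s \<theta> * ?F \<theta>) \<le> (b - a) / 2 * (indicator {0..pi} \<theta> * ?F \<theta>)" for \<theta>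
      using less by (auto simp: indicator_def intro!: mult_left_le_one_le sin_ge_zero)
  qed
  finally show "(LBINT x:{a<..<b}. \<bar>r x\<bar>) \<le>
      (b - a) / 2 * enn2real (\<integral>\<^sup>+\<theta>\<in>{0..pi}. ennreal (?F \<theta>) \<partial>lborel)"
    by (simp add: F[symmetric])
qed

text \<open>The geometric mean of x - a and b - x is at most their arithmetic mean (b - a)/2, so the
  weight is at least 2/(b - a).\<close>

lemma weighted_emeasure_le:
  fixes M :: "real measure"
  assumes less: "a < b" and sets: "sets M = sets (restrict_space borel {a<..<b})"
  shows "ennreal (2 / (b - a)) * emeasure M (space M) \<le>
    (\<integral>\<^sup>+x. ennreal (1 / sqrt ((x - a) * (b - x))) \<partial>M)"
proof -
  have sp: "space M = {a<..<b}"
    using sets_eq_imp_space_eq[OF sets] by (simp add: space_restrict_space)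
  have "ennreal (2 / (b - a)) * emeasure M (space M) = (\<integral>\<^sup>+x. ennreal (2 / (b - a)) \<partial>M)"
    by simp
  also have "\<dots> \<le> (\<integral>\<^sup>+x. ennreal (1 / sqrt ((x - a) * (b - x))) \<partial>M)"
  proof (rule nn_integral_mono)
    fix x assume "x \<in> space M"
    then have x: "a < x" "x < b" by (auto simp: sp)
    have "sqrt ((x - a) * (b - x)) \<le> (b - a) / 2"
      using arith_geo_mean_sqrt[of "x - a" "b - x"] x by simp
    moreover have "0 < sqrt ((x - a) * (b - x))" using x by simp
    ultimately have "1 / ((b - a) / 2) \<le> 1 / sqrt ((x - a) * (b - x))"
      by (intro frac_le) auto
    then show "ennreal (2 / (b - a)) \<le> ennreal (1 / sqrt ((x - a) * (b - x)))"
      by (intro ennreal_leI) simp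
  qed
  finally show ?thesis .
qed

text \<open>The value of \<open>T_norm\<close> is computed from a chosen derivative; the same choice
  furnishes M and N, so no uniqueness of weak derivatives is invoked.\<close>

lemma T_norm_finiteE:
  assumes less: "a < b" and fin: "T_norm a b h < \<infinity>"
  obtains M N where "weak_deriv_finite a b h M N"
    "measure M (space M) + measure N (space N) \<le> (b - a) / 2 * enn2real (T_norm a b h)"
proof (cases "\<exists>g. weak_deriv a b h g")
  case True
  define g where "g = (SOME g. weak_deriv a b h g)"
  have weak: "weak_deriv a b h g" unfolding g_def using True by (rule someI_ex)
  then have "loc_integrable a b g" by (simp add: weak_deriv_def)
  then obtain r where r [measurable]: "r \<in> borel_measurable borel"
    and AE: "AE x in lebesgue. x \<in> {a<..<b} \<longrightarrow> g x = r x"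
    by (rule loc_integrable_borel_rep)
  let ?N = "{\<theta> \<in> {0<..<pi}. g (G_map a b (cos \<theta>)) \<noteq> r (G_map a b (cos \<theta>))} \<union> {0, pi}"
  have "negligible ?N"
    using negligible_G_map_cos_vimage[OF less AE] by (simp add: negligible_Un)
  then have N: "AE \<theta> in lebesgue. \<theta> \<notin> ?N"
    by (intro AE_not_in) (simp add: negligible_iff_null_sets)
  have "T_norm a b h = (\<integral>\<^sup>+\<theta>\<in>{0..pi}. ennreal \<bar>g (G_map a b (cos \<theta>))\<bar> \<partial>lebesgue)"
    using True by (simp add: T_norm_def Let_def g_def)
  also have "\<dots> = (\<integral>\<^sup>+\<theta>\<in>{0..pi}. ennreal \<bar>r (G_map a b (cos \<theta>))\<bar> \<partial>lebesgue)"
  proof (rule nn_integral_cong_AE)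
    show "AE \<theta> in lebesgue. ennreal \<bar>g (G_map a b (cos \<theta>))\<bar> * indicator {0..pi} \<theta> =
        ennreal \<bar>r (G_map a b (cos \<theta>))\<bar> * indicator {0..pi} \<theta>"
      using N by eventually_elim (auto simp: indicator_def less_eq_real_def)
  qed
  also have "\<dots> = (\<integral>\<^sup>+\<theta>\<in>{0..pi}. ennreal \<bar>r (G_map a b (cos \<theta>))\<bar> \<partial>lborel)"
    by (rule nn_integral_completion)
  finally have T: "T_norm a b h = (\<integral>\<^sup>+\<theta>\<in>{0..pi}. ennreal \<bar>r (G_map a b (cos \<theta>))\<bar> \<partial>lborel)" .
  note r_int = integrable_on_interval_if_T_norm_finite[OF less r, folded T, OF fin]
  show thesis
    using weak_deriv_imp_finite[OF less weak r AE r_int(1)] r_int(2) that by metis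
next
  case False
  define M where "M = fst (SOME (M, N). weak_deriv_measure a b h M N)"
  define N where "N = snd (SOME (M, N). weak_deriv_measure a b h M N)"
  \<comment> \<open>Otherwise the last branch of \<open>T_norm\<close> would give
    \<infinity>.\<close>
  have ex: "\<exists>M N. weak_deriv_measure a b h M N"
    using False fin by (auto simp: T_norm_def split: if_splits)
  have weak: "weak_deriv_measure a b h M N"
    using someI_ex[of "\<lambda>(M, N). weak_deriv_measure a b h M N"] ex
    unfolding M_def N_def by (auto simp: case_prod_beta')
  let ?w = "\<lambda>x. ennreal (1 / sqrt ((x - a) * (b - x)))"
  have T: "T_norm a b h = (\<integral>\<^sup>+x. ?w x \<partial>M) + (\<integral>\<^sup>+x. ?w x \<partial>N)"
    using False ex by (simp add: T_norm_def Let_def M_def N_def case_prod_beta')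
  have sets: "sets M = sets (restrict_space borel {a<..<b})" "sets N = sets (restrict_space borel {a<..<b})"
    using weak by (auto simp: weak_deriv_measure_def jordan_pair_def)
  have le: "ennreal (2 / (b - a)) * (emeasure M (space M) + emeasure N (space N)) \<le> T_norm a b h"
    unfolding T distrib_left by (intro add_mono weighted_emeasure_le less sets)
  then have "ennreal (2 / (b - a)) * (emeasure M (space M) + emeasure N (space N)) < \<infinity>"
    using fin by simp
  then have "emeasure M (space M) \<noteq> \<infinity>" "emeasure N (space N) \<noteq> \<infinity>"
    using less by (auto simp: ennreal_mult_less_top)
  then have finite: "finite_measure M" "finite_measure N"
    by (auto intro: finite_measureI)
  then have fim: "finite_interval_measure a b M" "finite_interval_measure a b N"
    using less sets by (auto simp: finite_interval_measure_def finite_interval_measure_axioms_def)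
  have "weak_deriv_finite a b h M N"
    using fim weak by (simp add: weak_deriv_finite_def weak_deriv_measure_def)
  moreover have "measure M (space M) + measure N (space N) \<le> (b - a) / 2 * enn2real (T_norm a b h)"
  proof -
    have "ennreal (2 / (b - a) * (measure M (space M) + measure N (space N))) =
        ennreal (2 / (b - a)) * (emeasure M (space M) + emeasure N (space N))"
      by (subst ennreal_mult)
        (use less finite in \<open>auto simp: finite_measure.emeasure_eq_measure ennreal_plus\<close>)
    also have "\<dots> \<le> T_norm a b h" by (rule le)
    also have "\<dots> = ennreal (enn2real (T_norm a b h))"
      using fin by simp
    finally have "2 / (b - a) * (measure M (space M) + measure N (space N)) \<le> enn2real (T_norm a b h)"
      by simp
    then show ?thesis using less by (simp add: field_simps)
  qed
  ultimately show thesis by (rule that)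
qed

section \<open>The recurrence for Chebyshev coefficients\<close>

text \<open>Distribution functions are bounded by the total mass. This is how finiteness of one
  derivative yields a bounded density one level down.\<close>

lemma weak_deriv_finite_AE_bounded:
  assumes "weak_deriv_finite a b h M N"
  obtains r B where "r \<in> borel_measurable borel" "\<And>x. \<bar>r x\<bar> \<le> B"
    "AE x in lebesgue. x \<in> {a<..<b} \<longrightarrow> h x = r x"
proof -
  interpret M: finite_interval_measure a b M using assms by (simp add: weak_deriv_finite_def)
  interpret N: finite_interval_measure a b N using assms by (simp add: weak_deriv_finite_def)
  obtain C where C: "AE x in lebesgue. x \<in> {a<..<b} \<longrightarrow> h x = C + (cdf_on M x - cdf_on N x)"
    by (rule weak_deriv_finite_AE_eq[OF assms])
  show thesis
  proof (rule that[OF _ _ C])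
    show "\<bar>C + (cdf_on M x - cdf_on N x)\<bar> \<le> \<bar>C\<bar> + (measure M (space M) + measure N (space N))" for x
      using M.abs_cdf_on_le[of x] N.abs_cdf_on_le[of x] by linarith
  qed measurable
qed

lemma integrable_cheb:
  assumes r [measurable]: "r \<in> borel_measurable borel" and B: "\<And>x. \<bar>r x\<bar> \<le> B"
  shows "integrable lborel (\<lambda>\<theta>. (indicator {0..pi} \<theta> * cos (real i * \<theta>)) * r (G_map a b (cos \<theta>)))"
proof (rule Bochner_Integration.integrable_bound)
  show "integrable lborel (\<lambda>\<theta>. (indicator {0..pi} \<theta> * cos (real i * \<theta>)) * B)"
    by (rule integrable_mult_left[OF integrable_cos_indicator])
  show "AE \<theta> in lborel. norm ((indicator {0..pi} \<theta> * cos (real i * \<theta>)) * r (G_map a b (cos \<theta>))) \<le>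
      norm ((indicator {0..pi} \<theta> * cos (real i * \<theta>)) * B)"
  proof (rule AE_I2)
    fix \<theta>
    have "\<bar>r (G_map a b (cos \<theta>))\<bar> \<le> \<bar>B\<bar>" using B[of "G_map a b (cos \<theta>)"] by linarith
    then show "norm ((indicator {0..pi} \<theta> * cos (real i * \<theta>)) * r (G_map a b (cos \<theta>))) \<le>
        norm ((indicator {0..pi} \<theta> * cos (real i * \<theta>)) * B)"
      by (auto simp: abs_mult intro!: mult_left_mono)
  qed
qed measurable

text \<open>The measures M and N are handed out with the formula because the next level needs that
  h, too, has a finite derivative.\<close>

lemma cheb_coeff_recurrence:
  assumes less: "a < b" and weak: "weak_deriv a b h g" and r [measurable]: "r \<in> borel_measurable borel"
    and B: "\<And>x. \<bar>r x\<bar> \<le> B" and AE: "AE x in lebesgue. x \<in> {a<..<b} \<longrightarrow> g x = r x"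
  obtains M N where "weak_deriv_finite a b h M N"
    "\<And>j. 0 < j \<Longrightarrow> cheb_coeff a b h j =
      (b - a) / 2 * ((cheb_coeff a b g (j - 1) - cheb_coeff a b g (j + 1)) / (2 * real j))"
proof -
  have one: "set_integrable lborel {a<..<b} (\<lambda>x. 1::real)"
    by (rule set_integrable_subset[OF borel_integrable_atLeastAtMost'[of a b]]) auto
  have int: "set_integrable lborel {a<..<b} r"
    using set_integrable_mult_bounded[OF one _ r _ B] by simp
  obtain M N where MN: "weak_deriv_finite a b h M N"
    and diff: "\<And>f B. f \<in> borel_measurable borel \<Longrightarrow> (\<And>x. \<bar>f x\<bar> \<le> B) \<Longrightarrow>
      (\<integral>x. f x \<partial>M) - (\<integral>x. f x \<partial>N) = (LBINT x:{a<..<b}. r x * f x)"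
    by (rule weak_deriv_imp_finite[OF less weak r AE int]) blast
  have M: "finite_interval_measure a b M" and N: "finite_interval_measure a b N"
    using MN by (auto simp: weak_deriv_finite_def)
  obtain C where C: "AE x in lebesgue. x \<in> {a<..<b} \<longrightarrow> h x = C + (cdf_on M x - cdf_on N x)"
    by (rule weak_deriv_finite_AE_eq[OF MN])
  have rec: "cheb_coeff a b h j =
      (b - a) / 2 * ((cheb_coeff a b g (j - 1) - cheb_coeff a b g (j + 1)) / (2 * real j))" if j: "0 < j" for j
  proof -
    let ?S = "\<lambda>y. sin (real j * angle a b y)"
    let ?p = "\<lambda>i \<theta>. (indicator {0..pi} \<theta> * cos (real i * \<theta>)) * r (G_map a b (cos \<theta>))"
    have bound: "\<bar>?S y\<bar> \<le> 1" for y by (rule abs_sin_le_one)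
    have intS: "set_integrable lborel {a<..<b} (\<lambda>y. r y * ?S y)"
      by (rule set_integrable_mult_bounded[OF int r _ _ bound]) measurable
    have meas: "(\<lambda>\<theta>. ((b - a) / 2 * sin \<theta>) * (r (G_map a b (cos \<theta>)) * ?S (G_map a b (cos \<theta>))))
        \<in> borel_measurable borel"
      by measurable
    have "(\<lambda>y. r y * ?S y) absolutely_integrable_on {a<..<b}"
      by (subst absolutely_integrable_borel_iff) (use intS in auto)
    then have "(\<lambda>\<theta>. ((b - a) / 2 * sin \<theta>) * (r (G_map a b (cos \<theta>)) * ?S (G_map a b (cos \<theta>))))
          absolutely_integrable_on {0<..<pi} \<and>
        integral {0<..<pi} (\<lambda>\<theta>. ((b - a) / 2 * sin \<theta>) * (r (G_map a b (cos \<theta>)) * ?S (G_map a b (cos \<theta>)))) =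
        integral {a<..<b} (\<lambda>y. r y * ?S y)"
      \<comment> \<open>In the variable \<theta> the Jacobian contributes the factor sin \<theta>,
        and \<open>angle\<close> undoes the substitution inside the sine: the integrand contains sin
        \<theta> sin(j\<theta>).\<close>
      using change_of_variables_G_map_cos[OF less, of "\<lambda>y. r y * ?S y"] by blast
    then have "(LBINT y:{a<..<b}. r y * ?S y) =
        (LBINT \<theta>:{0<..<pi}. ((b - a) / 2 * sin \<theta>) * (r (G_map a b (cos \<theta>)) * ?S (G_map a b (cos \<theta>))))"
      using intS meas integral_borel_eq[of "\<lambda>y. r y * ?S y" "{a<..<b}"] integral_borel_eq[OF meas, of "{0<..<pi}"]
      by (simp add: absolutely_integrable_borel_iff)
    also have "\<dots> = (LBINT \<theta>. (b - a) / 4 * (?p (j - 1) \<theta> - ?p (j + 1) \<theta>))"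
      unfolding set_lebesgue_integral_def
    proof (rule Bochner_Integration.integral_cong[OF refl])
      fix \<theta> :: real
      \<comment> \<open>With j > 0 the natural number j - 1 is the true difference, also for j = 1,
        where the constant mode enters.\<close>
      have cos: "cos (real (j - 1) * \<theta>) - cos (real (j + 1) * \<theta>) = 2 * (sin \<theta> * sin (real j * \<theta>))"
        using j by (simp add: of_nat_diff distrib_right left_diff_distrib cos_add cos_diff)
      \<comment> \<open>The change of variables uses the open interval and the coefficients the
        closed one; at 0 and pi both sides vanish with sin \<theta>.\<close>
      consider "\<theta> \<in> {0<..<pi}" | "\<theta> \<in> {0, pi}" | "\<theta> \<notin> {0..pi}" by force
      then show "indicator {0<..<pi} \<theta> *\<^sub>R
          (((b - a) / 2 * sin \<theta>) * (r (G_map a b (cos \<theta>)) * ?S (G_map a b (cos \<theta>)))) =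
          (b - a) / 4 * (?p (j - 1) \<theta> - ?p (j + 1) \<theta>)"
      proof cases
        case 1
        then have "?p (j - 1) \<theta> - ?p (j + 1) \<theta> = 2 * (sin \<theta> * sin (real j * \<theta>)) * r (G_map a b (cos \<theta>))"
          by (simp add: cos[symmetric] left_diff_distrib)
        then show ?thesis using 1 angle_G_map[OF less, of \<theta>] by simp
      next
        case 2
        then have "?p (j - 1) \<theta> - ?p (j + 1) \<theta> = 2 * (sin \<theta> * sin (real j * \<theta>)) * r (G_map a b (cos \<theta>))"
          by (subst cos[symmetric]) (auto simp: left_diff_distrib)
        then show ?thesis using 2 by auto
      next
        case 3
        then have "\<theta> \<notin> {0<..<pi}" by auto
        then show ?thesis using 3 by simp
      qed
    qed
    also have "\<dots> = (b - a) / 4 * ((LBINT \<theta>. ?p (j - 1) \<theta>) - (LBINT \<theta>. ?p (j + 1) \<theta>))"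
      using integrable_cheb[OF r B] by (simp only: integral_mult_right_zero Bochner_Integration.integral_diff)
    also have "(LBINT \<theta>. ?p (j - 1) \<theta>) = pi / 2 * cheb_coeff a b g (j - 1)"
      by (simp add: cheb_coeff_cong_AE[OF less AE] cheb_coeff_borel[OF r])
    also have "(LBINT \<theta>. ?p (j + 1) \<theta>) = pi / 2 * cheb_coeff a b g (j + 1)"
      by (simp add: cheb_coeff_cong_AE[OF less AE] cheb_coeff_borel[OF r])
    finally have "(LBINT y:{a<..<b}. r y * ?S y) =
        (b - a) / 4 * (pi / 2 * cheb_coeff a b g (j - 1) - pi / 2 * cheb_coeff a b g (j + 1))" .
    moreover have "cheb_coeff a b h j = 2 / (pi * real j) * (LBINT y:{a<..<b}. r y * ?S y)"
      using cheb_coeff_cdf_on[OF M N C j] diff[OF _ bound] by simp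
    moreover have "2 / (pi * real j) * ((b - a) / 4 * (pi / 2 * X - pi / 2 * Y)) =
        (b - a) / 2 * ((X - Y) / (2 * real j))" for X Y
      using j by (simp add: field_simps)
    ultimately show ?thesis by (simp only:)
  qed
  show thesis using MN rec by (rule that)
qed

text \<open>With K = k + 1 the full product P arises from the left one by the last factor x + K and
  from the right one by the first factor x - K. So the reciprocals are (x + K)/P and (x - K)/P, with
  sum 2x/P.\<close>

lemma prod_shift_recurrence:
  fixes x :: real
  assumes "\<And>m. m \<le> Suc k \<Longrightarrow> x - real (Suc k) + 2 * real m > 0" and "x > 0"
  shows "(1 / (\<Prod>m\<le>k. (x - 1) - real k + 2 * real m) + 1 / (\<Prod>m\<le>k. (x + 1) - real k + 2 * real m)) / (2 * x) =
    1 / (\<Prod>m\<le>Suc k. x - real (Suc k) + 2 * real m)"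
proof -
  define K where "K = real (Suc k)"
  define P where "P = (\<Prod>m\<le>Suc k. x - real (Suc k) + 2 * real m)"
  define A where "A = (\<Prod>m\<le>k. (x - 1) - real k + 2 * real m)"
  define A' where "A' = (\<Prod>m\<le>k. (x + 1) - real k + 2 * real m)"
  have pos: "0 < P" unfolding P_def by (rule prod_pos) (use assms(1) in auto)
  have A: "P = A * (x + K)"
    unfolding P_def A_def K_def by (simp add: algebra_simps)
  have A': "P = (x - K) * A'"
    unfolding P_def A'_def K_def by (subst prod.atMost_Suc_shift) (simp add: algebra_simps)
  have nz: "x + K > 0" "x - K > 0"
    using assms(1)[of 0] assms(2) by (auto simp: K_def)
  have "1 / A = (x + K) / P" "1 / A' = (x - K) / P"
    using nz by (simp add: A, simp add: A')
  then have "(1 / A + 1 / A') / (2 * x) = 1 / P"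
    using pos assms(2) by (simp add: add_divide_distrib[symmetric])
  then show ?thesis by (simp only: A_def A'_def P_def)
qed

text \<open>The induction drops the head of the chain and leaves its last member, hence the norm,
  unchanged. The existence of M and N is carried along because the recurrence for \<open>D 0\<close>
  needs a bounded representative of \<open>D 1\<close>.\<close>

lemma abs_cheb_coeff_le_prod:
  assumes less: "a < b" and "\<And>i. i < k \<Longrightarrow> weak_deriv a b (D i) (D (Suc i))"
    and "T_norm a b (D k) < \<infinity>"
  shows "(\<exists>M N. weak_deriv_finite a b (D 0) M N) \<and>
    (\<forall>j\<ge>k + 1. \<bar>cheb_coeff a b (D 0) j\<bar> \<le>
      ((b - a) / 2) ^ (k + 1) * (2 * enn2real (T_norm a b (D k)) / pi) *
        (1 / (\<Prod>m\<le>k. real j - real k + 2 * real m)))"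
  using assms(2,3)
proof (induction k arbitrary: D)
  case 0
  let ?V = "enn2real (T_norm a b (D 0))"
  obtain M N where MN: "weak_deriv_finite a b (D 0) M N"
    and mass: "measure M (space M) + measure N (space N) \<le> (b - a) / 2 * ?V"
    by (rule T_norm_finiteE[OF less 0(2)])
  obtain C where C: "AE x in lebesgue. x \<in> {a<..<b} \<longrightarrow> D 0 x = C + (cdf_on M x - cdf_on N x)"
    by (rule weak_deriv_finite_AE_eq[OF MN])
  have "\<bar>cheb_coeff a b (D 0) j\<bar> \<le> (b - a) / 2 * (2 * ?V / pi) * (1 / real j)" if "j \<ge> 1" for j
  proof -
    have "\<bar>cheb_coeff a b (D 0) j\<bar> \<le> 2 / (pi * real j) * (measure M (space M) + measure N (space N))"
      by (rule abs_cheb_coeff_le[OF _ _ C]) (use MN that in \<open>auto simp: weak_deriv_finite_def\<close>)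
    also have "\<dots> \<le> 2 / (pi * real j) * ((b - a) / 2 * ?V)"
      by (rule mult_left_mono[OF mass]) auto
    finally show ?thesis by (simp add: field_simps)
  qed
  then show ?case using MN by auto
next
  case (Suc k)
  let ?c = "(b - a) / 2" and ?V = "enn2real (T_norm a b (D (Suc k)))"
  let ?Q = "\<lambda>k x. \<Prod>m\<le>k. x - real k + 2 * real m"
  have "\<exists>M N. weak_deriv_finite a b (D 1) M N"
    and bound: "\<And>j. j \<ge> k + 1 \<Longrightarrow> \<bar>cheb_coeff a b (D 1) j\<bar> \<le>
      ?c ^ (k + 1) * (2 * ?V / pi) * (1 / ?Q k (real j))"
    using Suc.IH[of "\<lambda>i. D (Suc i)"] Suc.prems by simp_all
  then obtain M N where "weak_deriv_finite a b (D 1) M N" by blast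
  then obtain r B where r: "r \<in> borel_measurable borel" "\<And>x. \<bar>r x\<bar> \<le> B"
    "AE x in lebesgue. x \<in> {a<..<b} \<longrightarrow> D 1 x = r x"
    using weak_deriv_finite_AE_bounded by blast
  have weak: "weak_deriv a b (D 0) (D 1)" using Suc.prems(1)[of 0] by simp
  obtain M N where MN: "weak_deriv_finite a b (D 0) M N"
    and rec: "\<And>j. 0 < j \<Longrightarrow> cheb_coeff a b (D 0) j =
      ?c * ((cheb_coeff a b (D 1) (j - 1) - cheb_coeff a b (D 1) (j + 1)) / (2 * real j))"
    using cheb_coeff_recurrence[OF less weak r] by blast
  have "\<bar>cheb_coeff a b (D 0) j\<bar> \<le> ?c ^ (Suc k + 1) * (2 * ?V / pi) * (1 / ?Q (Suc k) (real j))"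
    if j: "j \<ge> Suc k + 1" for j
  proof -
    let ?K = "?c ^ (k + 1) * (2 * ?V / pi)"
    have "\<bar>cheb_coeff a b (D 0) j\<bar> =
        ?c * (\<bar>cheb_coeff a b (D 1) (j - 1) - cheb_coeff a b (D 1) (j + 1)\<bar> / (2 * real j))"
      using less j by (simp add: rec abs_mult)
    also have "\<dots> \<le> ?c * ((?K * (1 / ?Q k (real (j - 1))) + ?K * (1 / ?Q k (real (j + 1)))) / (2 * real j))"
    proof (intro mult_left_mono divide_right_mono)
      \<comment> \<open>Both neighbours stay in the range of the induction hypothesis; the lower one
        does so exactly because j \<ge> k + 2.\<close>
      have "k + 1 \<le> j - 1" "k + 1 \<le> j + 1" using j by auto
      from this[THEN bound] show "\<bar>cheb_coeff a b (D 1) (j - 1) - cheb_coeff a b (D 1) (j + 1)\<bar> \<le>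
          ?K * (1 / ?Q k (real (j - 1))) + ?K * (1 / ?Q k (real (j + 1)))"
        by linarith
    qed (use less in auto)
    also have "\<dots> = ?c * (?K * ((1 / ?Q k (real j - 1) + 1 / ?Q k (real j + 1)) / (2 * real j)))"
      using j by (simp add: of_nat_diff distrib_left add.commute)
    also have "\<dots> = ?c * (?K * (1 / ?Q (Suc k) (real j)))"
      by (subst prod_shift_recurrence) (use j in auto)
    also have "\<dots> = ?c ^ (Suc k + 1) * (2 * ?V / pi) * (1 / ?Q (Suc k) (real j))"
      by (simp only: add_Suc power_Suc mult.assoc)
    finally show ?thesis .
  qed
  then show ?case using MN by blast
qed

text \<open>Even k uses l = u = s and x = j; odd k uses l = s, u = s + 1 and x = j - 1. In both
  cases x - 2l = j - k is the first factor.\<close>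

lemma prod_int_symmetric:
  fixes x :: real
  assumes "n = l + u"
  shows "(\<Prod>i = - int l..int u. x + 2 * real_of_int i) = (\<Prod>m\<le>n. x - 2 * real l + 2 * real m)"
proof (rule prod.reindex_bij_witness[of _ "\<lambda>m. int m - int l" "\<lambda>i. nat (i + int l)"])
qed (use assms in \<open>auto simp: algebra_simps\<close>)

theorem theorem3p1:
  fixes a b V :: real and k j :: nat
    and f :: "real \<Rightarrow> real" and D :: "nat \<Rightarrow> real \<Rightarrow> real"
  assumes "a < b"
    and "abs_cont_derivs a b k f D"
    and "T_norm a b (D k) < \<infinity>"
    and "V = enn2real (T_norm a b (D k))"
    and "j \<ge> k + 1"
  shows "(\<forall>s. k = 2 * s \<longrightarrow>
      \<bar>cheb_coeff a b f j\<bar> \<le>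
        ((b - a) / 2) ^ (2 * s + 1) *
          (2 * V / (pi * (\<Prod>i = - int s..int s. real j + 2 * real_of_int i)))) \<and>
    (\<forall>s. k = 2 * s + 1 \<longrightarrow>
      \<bar>cheb_coeff a b f j\<bar> \<le>
        ((b - a) / 2) ^ (2 * s + 2) *
          (2 * V / (pi * (\<Prod>i = - int s..int s + 1. real j + 2 * real_of_int i - 1))))"
proof -
  have "AE x in lebesgue. x \<in> {a<..<b} \<longrightarrow> f x = D 0 x"
    using assms(2) by (intro AE_I2) (auto simp: abs_cont_derivs_def)
  then have "cheb_coeff a b f j = cheb_coeff a b (D 0) j"
    by (rule cheb_coeff_cong_AE[OF assms(1)])
  moreover have "\<bar>cheb_coeff a b (D 0) j\<bar> \<le>
      ((b - a) / 2) ^ (k + 1) * (2 * V / pi) * (1 / (\<Prod>m\<le>k. real j - real k + 2 * real m))"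
    using abs_cheb_coeff_le_prod[where D = D and k = k, OF assms(1) _ assms(3)] assms(2,4,5)
    by (simp add: abs_cont_derivs_def)
  ultimately have main: "\<bar>cheb_coeff a b f j\<bar> \<le>
      ((b - a) / 2) ^ (k + 1) * (2 * V / (pi * (\<Prod>m\<le>k. real j - real k + 2 * real m)))"
    by simp
  show ?thesis
  proof (intro conjI allI impI)
    fix s assume k: "k = 2 * s"
    have "(\<Prod>i = - int s..int s. real j + 2 * real_of_int i) = (\<Prod>m\<le>k. real j - real k + 2 * real m)"
      using k by (subst prod_int_symmetric[of k]) auto
    then show "\<bar>cheb_coeff a b f j\<bar> \<le> ((b - a) / 2) ^ (2 * s + 1) *
        (2 * V / (pi * (\<Prod>i = - int s..int s. real j + 2 * real_of_int i)))"
      using main k by (simp only:)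
  next
    fix s assume k: "k = 2 * s + 1"
    have "(\<Prod>i = - int s..int s + 1. real j + 2 * real_of_int i - 1) =
        (\<Prod>m\<le>k. real j - real k + 2 * real m)"
      using k prod_int_symmetric[of k s "Suc s" "real j - 1"] by (simp add: algebra_simps)
    moreover have "k + 1 = 2 * s + 2" using k by simp
    ultimately show "\<bar>cheb_coeff a b f j\<bar> \<le> ((b - a) / 2) ^ (2 * s + 2) *
        (2 * V / (pi * (\<Prod>i = - int s..int s + 1. real j + 2 * real_of_int i - 1)))"
      using main by (simp only:)
  qed
qed

end
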